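(* Let $P$ be a finite $\varepsilon$-consistent poset, let $G$ be a subgroup of $\mathrm{Aut}(P,\varepsilon)$, let $\mathcal{Q}$ be the set of all saturations of $(P,\varepsilon)$, and let $(Q_1,\delta_1),\ldots,(Q_k,\delta_k)$ be representatives of the $G$-orbits of $\mathcal{Q}$ (under the action $g\cdot(Q,\delta)=(gQ,g\delta)$). Then, in $\mathrm{R}_G[[t]]$, \[ {\mathfrak{h}^*}^G_{P,\varepsilon}(t) = \sum_{i=1}^k \mathrm{Ind}^G_{\mathrm{stab}_G(Q_i,\delta_i)}\,\mathrm{Res}^{\mathrm{Aut}(Q_i, \delta_i)}_{\mathrm{stab}_G(Q_i,\delta_i)}\,{\mathfrak{h}^*}^{\mathrm{Aut}(Q_i, \delta_i)}_{Q_i, \delta_i}(t), \] where $\mathrm{stab}_G(Q_i,\delta_i)=\{g\in G \mid (gQ_i,g\delta_i)=(Q_i,\delta_i)\}$ (which is a subgroup of $\mathrm{Aut}(Q_i,\delta_i)$), and $\mathrm{Ind}$, $\mathrm{Res}$ are applied coefficientwise.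
   Context: All posets are finite. For a poset $P$, $E(P)$ is the set of covering relations $p\lessdot q$ ($p<q$ with no $z$ satisfying $p<z<q$). An edge labeling is a map $\varepsilon\colon E(P)\to\{-1,1\}$. For a saturated chain $\mathcal{C}\colon p_0\lessdot p_1\lessdot\cdots\lessdot p_m$ set $\varepsilon(\mathcal{C})=\sum_{i=0}^{m-1}\varepsilon(p_i\lessdot p_{i+1})$. $P$ is $\varepsilon$-graded if $\varepsilon(\mathcal{C})$ is the same for all maximal saturated chains $\mathcal{C}$ of $P$ (their lengths may differ). $P$ is $\varepsilon$-consistent if for every $y\in P$ the principal ideal $P_{\le y}$ is graded with respect to the restriction of $\varepsilon$; then the rank $\rho_P(x)$ is $\varepsilon(\mathcal{C})$ for any maximal saturated chain $\mathcal{C}$ of $P_{\le x}$. $\mathrm{Aut}(P,\varepsilon)$ is the group of poset automorphisms $\psi$ of $P$ with $\varepsilon(\psi(p)\lessdot\psi(q))=\varepsilon(p\lessdot q)$ for all $p\lessdot q\in E(P)$. Saturation: if $P$ is $\varepsilon$-consistent and $Q$ is $\delta$-consistent, $(Q,\delta)$ is a saturation of $(P,\varepsilon)$ if $Q=P$ as sets; any $x,y$ with $|\rho_Q(y)-\rho_Q(x)|=1$ are comparable in $Q$; $x<_P y$ implies $x<_Q y$; and $\rho_Q(x)=\rho_P(x)$ for all $x$. For $g\in\mathrm{Aut}(P,\varepsilon)$, $(gQ,g\delta)$ has the same underlying set, $x<_{gQ}y$ iff $g^{-1}x<_Q g^{-1}y$, and $g\delta(x\lessdot y)=\delta(g^{-1}x\lessdot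 g^{-1}y)$; this is again a saturation. Order polytope: $p<_P q$ form an ascending pair if every saturated chain $p=p_0\lessdot\cdots\lessdot p_m=q$ has all labels $\varepsilon(p_i\lessdot p_{i+1})=1$; otherwise a nonascending pair. For $m\in\mathbb{Z}_{>0}$, $m\mathscr{O}(P,\varepsilon)$ is the set of $f\colon P\to[0,m]$ with $f(p)\ge f(q)$ whenever $p\le_P q$ and $f(p)>f(q)$ whenever $p<_P q$ form a nonascending pair; $\mathscr{O}(P,\varepsilon)$ is the case $m=1$; $0\mathscr{O}(P,\varepsilon)$ is $\{0\}$ if $\varepsilon\equiv 1$ and empty otherwise. Equivariant $h^*$-series: $\mathrm{R}_G$ is the ring of virtual complex characters of the finite group $G$. A subgroup $G\le\mathrm{Aut}(P,\varepsilon)$ acts on $\mathbb{Z}^P$ by $g\cdot f=f\circ g^{-1}$, preserving each $m\mathscr{O}(P,\varepsilon)$; let $\chi_{m}$ be the character of the permutation representation on $m\mathscr{O}(P,\varepsilon)\cap\mathbb{Z}^P$, and let $\eta_G$ be the representation of $G$ on $\mathbb{C}^P$. Then ${\mathfrak{h}^*}^G_{P,\varepsilon}(t):=\big(\sum_{m\ge0}\chi_m t^m\big)\cdot(1-t)\cdot\sum_{i=0}^{|P|}(-1)^i\chi_{\wedge^i\eta_G}t^i\in\mathrm{R}_G[[t]]$. *)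

theory Defs
  imports
    Complex_Main
    "HOL-Library.FuncSet"
    "HOL-Library.Function_Algebras"
    "HOL-Combinatorics.Permutations"
    "HOL-Computational_Algebra.Formal_Power_Series"
    "HOL-Algebra.Group_Action"
begin

section \<open>Edge-labelled finite posets\<close>

text \<open>
  The order is the reflexive one, as a set of pairs contained in the square of the ground set.
  The labelling is \<open>undefined\<close> away from the covering relations, so that equality of records is
  equality of pairs (poset, edge labelling).
\<close>

record 'a lposet =
  lp_elems :: "'a set"
  lp_le :: "('a \<times> 'a) set"
  lp_lab :: "'a \<times> 'a \<Rightarrow> int"

definition lp_less :: "'a lposet \<Rightarrow> ('a \<times> 'a) set" where
  "lp_less P = lp_le P - Id"

definition lp_covers :: "'a lposet \<Rightarrow> ('a \<times> 'a) set" where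
  "lp_covers P = {(p, q). (p, q) \<in> lp_less P \<and> (\<nexists>z. (p, z) \<in> lp_less P \<and> (z, q) \<in> lp_less P)}"

definition labelled_poset :: "'a lposet \<Rightarrow> bool" where
  "labelled_poset P \<longleftrightarrow>
     finite (lp_elems P) \<and> partial_order_on (lp_elems P) (lp_le P) \<and>
     lp_lab P \<in> lp_covers P \<rightarrow>\<^sub>E {-1, 1}"

definition saturated_chain :: "'a lposet \<Rightarrow> 'a list \<Rightarrow> bool" where
  "saturated_chain P c \<longleftrightarrow>
     c \<noteq> [] \<and> set c \<subseteq> lp_elems P \<and> (\<forall>i. Suc i < length c \<longrightarrow> (c ! i, c ! Suc i) \<in> lp_covers P)"

definition chain_label :: "'a lposet \<Rightarrow> 'a list \<Rightarrow> int" where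
  "chain_label P c = (\<Sum>i<length c - 1. lp_lab P (c ! i, c ! Suc i))"

definition maximal_saturated_chain :: "'a lposet \<Rightarrow> 'a list \<Rightarrow> bool" where
  "maximal_saturated_chain P c \<longleftrightarrow>
     saturated_chain P c \<and> (\<nexists>d. saturated_chain P d \<and> set c \<subset> set d)"

definition eps_graded :: "'a lposet \<Rightarrow> bool" where
  "eps_graded P \<longleftrightarrow>
     (\<forall>c d. maximal_saturated_chain P c \<longrightarrow> maximal_saturated_chain P d \<longrightarrow>
        chain_label P c = chain_label P d)"

text \<open>The covering relations of a principal ideal are those of \<open>P\<close> lying in the ideal.\<close>

definition principal_ideal :: "'a lposet \<Rightarrow> 'a \<Rightarrow> 'a lposet" where
  "principal_ideal P y =
     (let I = {x. (x, y) \<in> lp_le P} in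
      \<lparr>lp_elems = I, lp_le = lp_le P \<inter> I \<times> I,
       lp_lab = restrict (lp_lab P) (lp_covers P \<inter> I \<times> I)\<rparr>)"

definition eps_consistent :: "'a lposet \<Rightarrow> bool" where
  "eps_consistent P \<longleftrightarrow> labelled_poset P \<and> (\<forall>y\<in>lp_elems P. eps_graded (principal_ideal P y))"

definition lp_rank :: "'a lposet \<Rightarrow> 'a \<Rightarrow> int" where
  "lp_rank P x =
     (THE r. \<exists>c. maximal_saturated_chain (principal_ideal P x) c \<and>
                 chain_label (principal_ideal P x) c = r)"

section \<open>Automorphisms and saturations\<close>

definition lp_aut :: "'a lposet \<Rightarrow> ('a \<Rightarrow> 'a) set" where
  "lp_aut P =
     {\<psi> \<in> Bij (lp_elems P).
        (\<forall>p\<in>lp_elems P. \<forall>q\<in>lp_elems P. (\<psi> p, \<psi> q) \<in> lp_le P \<longleftrightarrow> (p, q) \<in> lp_le P) \<and>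
        (\<forall>(p, q)\<in>lp_covers P. lp_lab P (\<psi> p, \<psi> q) = lp_lab P (p, q))}"

definition lp_aut_group :: "'a lposet \<Rightarrow> ('a \<Rightarrow> 'a) monoid" where
  "lp_aut_group P = (BijGroup (lp_elems P))\<lparr>carrier := lp_aut P\<rparr>"

definition saturation :: "'a lposet \<Rightarrow> 'a lposet \<Rightarrow> bool" where
  "saturation P Q \<longleftrightarrow>
     eps_consistent P \<and> eps_consistent Q \<and> lp_elems Q = lp_elems P \<and>
     (\<forall>x\<in>lp_elems P. \<forall>y\<in>lp_elems P.
        \<bar>lp_rank Q y - lp_rank Q x\<bar> = 1 \<longrightarrow> (x, y) \<in> lp_le Q \<or> (y, x) \<in> lp_le Q) \<and>
     lp_less P \<subseteq> lp_less Q \<and>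
     (\<forall>x\<in>lp_elems P. lp_rank Q x = lp_rank P x)"

definition saturations :: "'a lposet \<Rightarrow> 'a lposet set" where
  "saturations P = {Q. saturation P Q}"

definition lp_act :: "('a \<Rightarrow> 'a) \<Rightarrow> 'a lposet \<Rightarrow> 'a lposet" where
  "lp_act g Q =
     (let X = lp_elems Q; h = inv_into X g in
      \<lparr>lp_elems = X,
       lp_le = {(x, y) \<in> X \<times> X. (h x, h y) \<in> lp_le Q},
       lp_lab = (\<lambda>(x, y)\<in>{(x, y) \<in> X \<times> X. (h x, h y) \<in> lp_covers Q}. lp_lab Q (h x, h y))\<rparr>)"

section \<open>Order polytopes\<close>

definition ascending_pair :: "'a lposet \<Rightarrow> 'a \<Rightarrow> 'a \<Rightarrow> bool" where
  "ascending_pair P p q \<longleftrightarrow>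
     (p, q) \<in> lp_less P \<and>
     (\<forall>c. saturated_chain P c \<and> hd c = p \<and> last c = q \<longrightarrow>
        (\<forall>i. Suc i < length c \<longrightarrow> lp_lab P (c ! i, c ! Suc i) = 1))"

definition nonascending_pair :: "'a lposet \<Rightarrow> 'a \<Rightarrow> 'a \<Rightarrow> bool" where
  "nonascending_pair P p q \<longleftrightarrow> (p, q) \<in> lp_less P \<and> \<not> ascending_pair P p q"

definition order_polytope :: "nat \<Rightarrow> 'a lposet \<Rightarrow> ('a \<Rightarrow> real) set" where
  "order_polytope m P =
     (if m = 0 then
        (if \<forall>e\<in>lp_covers P. lp_lab P e = 1 then {\<lambda>p\<in>lp_elems P. 0} else {})
      else
        {f \<in> lp_elems P \<rightarrow>\<^sub>E {0..real m}.
           (\<forall>(p, q)\<in>lp_le P. f p \<ge> f q) \<and> (\<forall>p q. nonascending_pair P p q \<longrightarrow> f p > f q)})"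

definition lattice_points :: "nat \<Rightarrow> 'a lposet \<Rightarrow> ('a \<Rightarrow> real) set" where
  "lattice_points m P = {f \<in> order_polytope m P. \<forall>p\<in>lp_elems P. f p \<in> \<int>}"

definition fun_act :: "'a set \<Rightarrow> ('a \<Rightarrow> 'a) \<Rightarrow> ('a \<Rightarrow> 'b) \<Rightarrow> 'a \<Rightarrow> 'b" where
  "fun_act X g f = (\<lambda>p\<in>X. f (inv_into X g p))"

section \<open>Characters\<close>

text \<open>
  Every complex vector space used here is a space of complex-valued functions; \<open>\<complex>\<^sup>X\<close> is
  realised as the functions vanishing outside \<open>X\<close>.
\<close>

definition scale_fun :: "complex \<Rightarrow> ('x \<Rightarrow> complex) \<Rightarrow> 'x \<Rightarrow> complex" where
  "scale_fun c v = (\<lambda>x. c * v x)"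

interpretation cfun: vector_space scale_fun
  by unfold_locales (simp_all add: scale_fun_def fun_eq_iff algebra_simps)

definition coord_space :: "'x set \<Rightarrow> ('x \<Rightarrow> complex) set" where
  "coord_space X = {v. \<forall>x. x \<notin> X \<longrightarrow> v x = 0}"

definition std_basis :: "'x \<Rightarrow> 'x \<Rightarrow> complex" where
  "std_basis y = (\<lambda>x. if x = y then 1 else 0)"

text \<open>
  The trace of an endomorphism \<open>T\<close> of a finite-dimensional subspace \<open>V\<close>, computed
  in some basis; the value does not depend on the basis.
\<close>

definition trace_on :: "('x \<Rightarrow> complex) set \<Rightarrow> (('x \<Rightarrow> complex) \<Rightarrow> 'x \<Rightarrow> complex) \<Rightarrow> complex" where
  "trace_on V T =
     (let B = (SOME B. cfun.independent B \<and> cfun.span B = V)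
      in \<Sum>b\<in>B. cfun.representation B (T b) b)"

text \<open>
  Elements of \<open>R\<^sub>G\<close> are functions on the carrier of \<open>G\<close>, extended by 0. Thus \<open>R\<^sub>G[[t]]\<close> lies
  in the power series over the pointwise ring of functions, with the pointwise product.
\<close>

definition rep_character ::
    "('g, 'm) monoid_scheme \<Rightarrow> ('x \<Rightarrow> complex) set \<Rightarrow>
     ('g \<Rightarrow> ('x \<Rightarrow> complex) \<Rightarrow> 'x \<Rightarrow> complex) \<Rightarrow> 'g \<Rightarrow> complex" where
  "rep_character G V \<rho> = (\<lambda>g. if g \<in> carrier G then trace_on V (\<rho> g) else 0)"

text \<open>
  For an action \<open>\<phi>\<close> of \<open>G\<close> on \<open>X\<close>, the representation on \<open>\<complex>\<^sup>X\<close> sending the basis vector at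
  \<open>x\<close> to the one at \<open>\<phi> g x\<close>.
\<close>

definition perm_rep ::
    "('g, 'm) monoid_scheme \<Rightarrow> 'x set \<Rightarrow> ('g \<Rightarrow> 'x \<Rightarrow> 'x) \<Rightarrow>
     'g \<Rightarrow> ('x \<Rightarrow> complex) \<Rightarrow> 'x \<Rightarrow> complex" where
  "perm_rep G X \<phi> g v = (\<lambda>x. if x \<in> X then v (\<phi> (inv\<^bsub>G\<^esub> g) x) else 0)"

text \<open>
  The \<open>i\<close>-th exterior power of \<open>\<complex>\<^sup>X\<close> is realised as the alternating tensors inside the \<open>i\<close>-th
  tensor power, the latter being the functions on \<open>tuples X i\<close>. A linear map \<open>A\<close> acts on
  tensors by its \<open>i\<close>-th tensor power, \<open>A (std_basis y) x\<close> being the \<open>(x, y)\<close> entry of its matrix.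
\<close>

definition tuples :: "'x set \<Rightarrow> nat \<Rightarrow> 'x list set" where
  "tuples X i = {xs. set xs \<subseteq> X \<and> length xs = i}"

definition ext_power :: "'x set \<Rightarrow> nat \<Rightarrow> ('x list \<Rightarrow> complex) set" where
  "ext_power X i =
     {w \<in> coord_space (tuples X i).
        \<forall>xs\<in>tuples X i. \<forall>\<sigma>. \<sigma> permutes {..<i} \<longrightarrow> w (permute_list \<sigma> xs) = of_int (sign \<sigma>) * w xs}"

definition ext_power_map ::
    "'x set \<Rightarrow> nat \<Rightarrow> (('x \<Rightarrow> complex) \<Rightarrow> 'x \<Rightarrow> complex) \<Rightarrow>
     ('x list \<Rightarrow> complex) \<Rightarrow> 'x list \<Rightarrow> complex" where
  "ext_power_map X i A w =
     (\<lambda>xs. if xs \<in> tuples X i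
           then \<Sum>ys\<in>tuples X i. (\<Prod>j<i. A (std_basis (ys ! j)) (xs ! j)) * w ys
           else 0)"

definition res_char :: "'g set \<Rightarrow> ('g \<Rightarrow> complex) \<Rightarrow> 'g \<Rightarrow> complex" where
  "res_char H \<chi> = (\<lambda>g. if g \<in> H then \<chi> g else 0)"

definition ind_char ::
    "('g, 'm) monoid_scheme \<Rightarrow> 'g set \<Rightarrow> ('g \<Rightarrow> complex) \<Rightarrow> 'g \<Rightarrow> complex" where
  "ind_char G H \<chi> =
     (\<lambda>g. if g \<in> carrier G
          then (\<Sum>x\<in>{x \<in> carrier G. inv\<^bsub>G\<^esub> x \<otimes>\<^bsub>G\<^esub> g \<otimes>\<^bsub>G\<^esub> x \<in> H}.
                  \<chi> (inv\<^bsub>G\<^esub> x \<otimes>\<^bsub>G\<^esub> g \<otimes>\<^bsub>G\<^esub> x)) / of_nat (card H)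
          else 0)"

definition fps_coeffwise :: "('b \<Rightarrow> 'c) \<Rightarrow> 'b::zero fps \<Rightarrow> 'c::zero fps" where
  "fps_coeffwise F s = Abs_fps (\<lambda>n. F (fps_nth s n))"

section \<open>The equivariant \<open>h\<^sup>*\<close>-series\<close>

definition lattice_char :: "('a \<Rightarrow> 'a) monoid \<Rightarrow> 'a lposet \<Rightarrow> nat \<Rightarrow> ('a \<Rightarrow> 'a) \<Rightarrow> complex" where
  "lattice_char G P m =
     rep_character G (coord_space (lattice_points m P))
       (perm_rep G (lattice_points m P) (fun_act (lp_elems P)))"

definition ext_power_char :: "('a \<Rightarrow> 'a) monoid \<Rightarrow> 'a lposet \<Rightarrow> nat \<Rightarrow> ('a \<Rightarrow> 'a) \<Rightarrow> complex" where
  "ext_power_char G P i =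
     rep_character G (ext_power (lp_elems P) i)
       (\<lambda>g. ext_power_map (lp_elems P) i (perm_rep G (lp_elems P) (\<lambda>g. g) g))"

definition h_star :: "('a \<Rightarrow> 'a) monoid \<Rightarrow> 'a lposet \<Rightarrow> (('a \<Rightarrow> 'a) \<Rightarrow> complex) fps" where
  "h_star G P =
     Abs_fps (lattice_char G P) * (1 - fps_X) *
     (\<Sum>i\<le>card (lp_elems P). fps_const ((-1) ^ i * ext_power_char G P i) * fps_X ^ i)"

end

theory Submission
  imports Defs
begin

text \<open>
  Let \<open>\<rho>\<close> be the rank function of \<open>P\<close>. A point \<open>f\<close> of \<open>m\<O>(P,\<epsilon>)\<close> lies in \<open>m\<O>(Q,\<delta>)\<close> for exactly one
  saturation, namely the one whose strict order is generated by the pairs \<open>(x, y)\<close> with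
  \<open>\<rho> y = \<rho> x + 1\<close> and \<open>f y \<le> f x\<close>, or \<open>\<rho> y = \<rho> x - 1\<close> and \<open>f y < f x\<close>: this relation is acyclic
  because it decreases \<open>f\<close> and, among ties, increases \<open>\<rho>\<close>, and comparability of ranks at distance
  one forces every such pair into the order of \<open>Q\<close>. Hence the lattice points of \<open>P\<close> are the disjoint
  union of those of its saturations. By uniqueness, a lattice point fixed by \<open>g\<close> lies in a saturation
  fixed by \<open>g\<close>, so the permutation character at \<open>g\<close> is the sum over the fixed saturations. The
  exterior powers give the same class function for \<open>P\<close> and for every saturation, so the identity
  follows from the formula for induced characters and the orbit-stabilizer theorem.
\<close>

section \<open>Saturated chains and ranks\<close>

text \<open>Two reductions shape the proof. First, chains are traded for covering relations. A
  labelled poset is consistent iff some function vanishes on the minimal elements and changes along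
  each cover by its label, and on the ground set that function is the rank. In a saturation the
  labels are thus forced to be rank differences, so its order alone determines it, and membership in
  the order polytope is a condition on covers that is uniform in m. Second, the series of Q_i lives
  over Aut(Q_i), not over G. Each coefficient, evaluated at g, depends on the labelled poset and on
  g only (\<open>h_star_coeff\<close>); the group merely fixes the support. In the induced-character
  formula, x^(-1) g x stabilizes Q iff g stabilizes xQ, and the coefficient for Q at x^(-1) g x is
  the one for xQ at g, so the sum over x runs through the orbit of Q, each member counted once per
  stabilizer element. For the exterior powers this conjugation invariance rests on tr(ST) = tr(TS)
  alone, and no trace on them is evaluated. Since \<open>trace_on\<close> takes an arbitrary basis,
  that identity is proved with one basis on each side, which also yields independence of the
  basis.\<close>

definition lp_minimal :: "'a lposet \<Rightarrow> 'a \<Rightarrow> bool" where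
  "lp_minimal P x \<longleftrightarrow> x \<in> lp_elems P \<and> (\<forall>z. (z, x) \<notin> lp_less P)"

lemma lp_less_iff: "(x, y) \<in> lp_less P \<longleftrightarrow> (x, y) \<in> lp_le P \<and> x \<noteq> y"
  by (auto simp: lp_less_def)

lemma lp_covers_less: "(x, y) \<in> lp_covers P \<Longrightarrow> (x, y) \<in> lp_less P"
  by (auto simp: lp_covers_def)

lemma labelled_posetD:
  assumes "labelled_poset P"
  shows "finite (lp_elems P)" "lp_le P \<subseteq> lp_elems P \<times> lp_elems P"
    "x \<in> lp_elems P \<Longrightarrow> (x, x) \<in> lp_le P" "trans (lp_le P)" "antisym (lp_le P)"
    "lp_lab P \<in> lp_covers P \<rightarrow>\<^sub>E {-1, 1}"
  using assms unfolding labelled_poset_def partial_order_on_def preorder_on_def refl_on_def by auto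

lemma lp_less_elems:
  "labelled_poset P \<Longrightarrow> (x, y) \<in> lp_less P \<Longrightarrow> x \<in> lp_elems P \<and> y \<in> lp_elems P"
  using labelled_posetD(2)[of P] by (auto simp: lp_less_iff)

lemma lp_le_iff:
  "labelled_poset P \<Longrightarrow> (x, y) \<in> lp_le P \<longleftrightarrow> (x, y) \<in> lp_less P \<or> (x = y \<and> x \<in> lp_elems P)"
  using labelled_posetD(2,3)[of P] by (auto simp: lp_less_iff)

lemma trans_lp_less: "labelled_poset P \<Longrightarrow> trans (lp_less P)"
  unfolding lp_less_def by (auto intro!: trans_diff_Id dest: labelled_posetD(4,5))

lemma lp_less_trans:
  "labelled_poset P \<Longrightarrow> (x, y) \<in> lp_less P \<Longrightarrow> (y, z) \<in> lp_less P \<Longrightarrow> (x, z) \<in> lp_less P"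
  using trans_lp_less by (meson transD)

lemma lp_less_irrefl: "(x, x) \<notin> lp_less P"
  by (simp add: lp_less_iff)

lemma lab_covers: "labelled_poset P \<Longrightarrow> e \<in> lp_covers P \<Longrightarrow> lp_lab P e = -1 \<or> lp_lab P e = 1"
  using labelled_posetD(6)[of P] by auto

text \<open>Induction on the number of elements strictly between x and y: an element in between
  splits the interval into two strictly smaller ones, and an empty interval is a cover. Finiteness
  of the poset enters here.\<close>

lemma trancl_lp_covers:
  assumes "labelled_poset P"
  shows "(lp_covers P)\<^sup>+ = lp_less P"
proof
  have "(lp_covers P)\<^sup>+ \<subseteq> (lp_less P)\<^sup>+"
    by (rule trancl_mono_subset) (auto dest: lp_covers_less)
  then show "(lp_covers P)\<^sup>+ \<subseteq> lp_less P"
    using trancl_id[OF trans_lp_less[OF assms]] by simp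
  show "lp_less P \<subseteq> (lp_covers P)\<^sup>+"
  proof clarify
    fix x y assume "(x, y) \<in> lp_less P"
    then show "(x, y) \<in> (lp_covers P)\<^sup>+"
    proof (induction "card {z. (x, z) \<in> lp_less P \<and> (z, y) \<in> lp_less P}" arbitrary: x y
        rule: less_induct)
      case less
      let ?I = "\<lambda>x y. {z. (x, z) \<in> lp_less P \<and> (z, y) \<in> lp_less P}"
      have fin: "finite (?I x y)" for x y
        by (rule finite_subset[OF _ labelled_posetD(1)[OF assms]]) (auto dest: lp_less_elems[OF assms])
      show ?case
      proof (cases "?I x y = {}")
        case True
        with less.prems show ?thesis by (auto simp: lp_covers_def intro!: r_into_trancl)
      next
        case False
        then obtain z where z: "(x, z) \<in> lp_less P" "(z, y) \<in> lp_less P" by auto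
        have sub: "?I x z \<subseteq> ?I x y" "?I z y \<subseteq> ?I x y"
          using z by (auto intro: lp_less_trans[OF assms])
        moreover have "z \<in> ?I x y" "z \<notin> ?I x z" "z \<notin> ?I z y"
          using z by (auto simp: lp_less_irrefl)
        ultimately have "?I x z \<subset> ?I x y" "?I z y \<subset> ?I x y" by blast+
        then have "card (?I x z) < card (?I x y)" "card (?I z y) < card (?I x y)"
          using psubset_card_mono[OF fin] by auto
        then show ?thesis
          using less.hyps z by (meson trancl_trans)
      qed
    qed
  qed
qed

lemma obtain_lower_cover:
  assumes "labelled_poset P" "(x, y) \<in> lp_less P"
  obtains z where "(z, y) \<in> lp_covers P" "(x, z) \<in> lp_le P"
proof -
  have "(x, y) \<in> (lp_covers P)\<^sup>* O lp_covers P"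
    using assms trancl_lp_covers trancl_unfold_right by metis
  then obtain z where z: "(z, y) \<in> lp_covers P" "(x, z) \<in> (lp_covers P)\<^sup>*" by blast
  then have "x = z \<or> (x, z) \<in> lp_less P"
    using trancl_lp_covers[OF assms(1)] by (auto simp: rtrancl_eq_or_trancl)
  then have "(x, z) \<in> lp_le P"
    using lp_less_elems[OF assms] by (auto simp: lp_le_iff[OF assms(1)])
  with z show thesis using that by blast
qed

lemma obtain_upper_cover:
  assumes "labelled_poset P" "(x, y) \<in> lp_less P"
  obtains z where "(x, z) \<in> lp_covers P" "(z, y) \<in> lp_le P"
proof -
  have "(x, y) \<in> lp_covers P O (lp_covers P)\<^sup>*"
    using assms trancl_lp_covers trancl_unfold_left by metis
  then obtain z where z: "(x, z) \<in> lp_covers P" "(z, y) \<in> (lp_covers P)\<^sup>*" by blast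
  then have "z = y \<or> (z, y) \<in> lp_less P"
    using trancl_lp_covers[OF assms(1)] by (auto simp: rtrancl_eq_or_trancl)
  then have "(z, y) \<in> lp_le P"
    using lp_less_elems[OF assms] by (auto simp: lp_le_iff[OF assms(1)])
  with z show thesis using that by blast
qed

section \<open>Labels and comparability along saturated chains\<close>

lemma saturated_chain_iff:
  "saturated_chain P c \<longleftrightarrow>
     c \<noteq> [] \<and> set c \<subseteq> lp_elems P \<and> successively (\<lambda>x y. (x, y) \<in> lp_covers P) c"
  by (simp add: saturated_chain_def successively_conv_nth)

lemma chain_label_snoc:
  assumes "c \<noteq> []"
  shows "chain_label P (c @ [q]) = chain_label P c + lp_lab P (last c, q)"
proof -
  obtain n where n: "length c = Suc n" using assms by (cases c) auto
  have "(\<Sum>i<n. lp_lab P ((c @ [q]) ! i, (c @ [q]) ! Suc i)) = (\<Sum>i<n. lp_lab P (c ! i, c ! Suc i))"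
    by (rule sum.cong) (auto simp: nth_append n)
  then show ?thesis
    by (simp add: chain_label_def n nth_append last_conv_nth[OF assms])
qed

lemma saturated_chain_snoc:
  assumes "labelled_poset P" "c \<noteq> []"
  shows "saturated_chain P (c @ [q]) \<longleftrightarrow> saturated_chain P c \<and> (last c, q) \<in> lp_covers P"
  using assms by (auto simp: saturated_chain_iff successively_append_iff dest: lp_covers_less lp_less_elems)

lemma saturated_chain_Cons:
  assumes "labelled_poset P" "c \<noteq> []"
  shows "saturated_chain P (q # c) \<longleftrightarrow> saturated_chain P c \<and> (q, hd c) \<in> lp_covers P"
  using assms by (auto simp: saturated_chain_iff successively_Cons dest: lp_covers_less lp_less_elems)

lemma saturated_chain_hd_le_last:
  assumes "labelled_poset P" "saturated_chain P c"
  shows "x \<in> set c \<Longrightarrow> (hd c, x) \<in> lp_le P \<and> (x, last c) \<in> lp_le P"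
  using assms(2)
proof (induction c arbitrary: x)
  case (Cons a c)
  show ?case
  proof (cases "c = []")
    case True
    then show ?thesis using Cons.prems labelled_posetD(3)[OF assms(1)]
      by (auto simp: saturated_chain_iff)
  next
    case False
    with Cons.prems have sat: "saturated_chain P c" and "(a, hd c) \<in> lp_covers P"
      by (auto simp: saturated_chain_Cons[OF assms(1)])
    then have a: "(a, hd c) \<in> lp_le P" by (auto dest!: lp_covers_less simp: lp_less_iff)
    have ta: "(a, z) \<in> lp_le P \<and> (z, last c) \<in> lp_le P" if "z \<in> set c" for z
      using Cons.IH[OF that sat] a labelled_posetD(4)[OF assms(1)] by (meson transD)
    have "(a, a) \<in> lp_le P" using Cons.prems labelled_posetD(3)[OF assms(1)]
      by (auto simp: saturated_chain_iff)
    moreover have "(a, last c) \<in> lp_le P" using ta[of "last c"] False by auto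
    ultimately show ?thesis
      using Cons.prems False ta by auto
  qed
qed simp

text \<open>Consecutive members of a saturated chain have nothing strictly between them, so an
  element above one member and comparable with the next is above or equal to that next one. Going up
  the chain this way, z must coincide with a member. Hence a saturated chain cannot be refined
  between its ends.\<close>

lemma saturated_chain_mem_if_comparable:
  assumes "labelled_poset P" "saturated_chain P c"
    and "\<And>x. x \<in> set c \<Longrightarrow> (x, z) \<in> lp_le P \<or> (z, x) \<in> lp_le P"
    and "(hd c, z) \<in> lp_le P" "(z, last c) \<in> lp_le P"
  shows "z \<in> set c"
  using assms(2-)
proof (induction c)
  case Nil
  then show ?case by (simp add: saturated_chain_iff)
next
  case (Cons a c)
  show ?case
  proof (cases "z = a \<or> c = []")
    case True
    then show ?thesis using Cons.prems labelled_posetD(5)[OF assms(1)] by (auto dest: antisymD)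
  next
    case False
    with Cons.prems have sat: "saturated_chain P c" and cov: "(a, hd c) \<in> lp_covers P"
      by (auto simp: saturated_chain_Cons[OF assms(1)])
    have az: "(a, z) \<in> lp_less P" using Cons.prems False by (auto simp: lp_less_iff)
    have "(z, hd c) \<notin> lp_less P" using az cov by (auto simp: lp_covers_def)
    moreover have "(hd c, z) \<in> lp_le P \<or> (z, hd c) \<in> lp_le P" using Cons.prems(2) False by auto
    ultimately have "(hd c, z) \<in> lp_le P" by (auto simp: lp_less_iff)
    then have "z \<in> set c" using Cons.IH[OF sat] Cons.prems False by auto
    then show ?thesis by simp
  qed
qed

lemma saturated_chain_comparable:
  assumes "labelled_poset P" "saturated_chain P c" "x \<in> set c" "y \<in> set c"
  shows "(x, y) \<in> lp_le P \<or> (y, x) \<in> lp_le P"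
  using assms(2-)
proof (induction c)
  case (Cons a c)
  show ?case
  proof (cases "x = a \<or> y = a")
    case True
    then show ?thesis using saturated_chain_hd_le_last[OF assms(1) Cons.prems(1)] Cons.prems by auto
  next
    case False
    then have "c \<noteq> []" using Cons.prems by auto
    then show ?thesis using False Cons by (auto simp: saturated_chain_Cons[OF assms(1)])
  qed
qed simp

text \<open>An ideal is closed downwards, so any element strictly between two of its members lies in
  it as well; passing to the ideal creates no new covers.\<close>

lemma principal_ideal_simps:
  assumes "labelled_poset P"
  shows "lp_elems (principal_ideal P y) = {x. (x, y) \<in> lp_le P}"
    and "lp_covers (principal_ideal P y) = lp_covers P \<inter> {x. (x, y) \<in> lp_le P} \<times> {x. (x, y) \<in> lp_le P}"
    and "lp_lab (principal_ideal P y) =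
      restrict (lp_lab P) (lp_covers P \<inter> {x. (x, y) \<in> lp_le P} \<times> {x. (x, y) \<in> lp_le P})"
proof -
  have down: "(z, y) \<in> lp_le P" if "(z, x) \<in> lp_le P" "(x, y) \<in> lp_le P" for x z
    using that labelled_posetD(4)[OF assms] by (meson transD)
  show "lp_elems (principal_ideal P y) = {x. (x, y) \<in> lp_le P}"
    "lp_lab (principal_ideal P y) =
      restrict (lp_lab P) (lp_covers P \<inter> {x. (x, y) \<in> lp_le P} \<times> {x. (x, y) \<in> lp_le P})"
    by (simp_all add: principal_ideal_def Let_def)
  have less: "(a, b) \<in> lp_less (principal_ideal P y) \<longleftrightarrow> (a, b) \<in> lp_less P \<and> (b, y) \<in> lp_le P" for a b
    using down by (auto simp: principal_ideal_def Let_def lp_less_iff)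
  show "lp_covers (principal_ideal P y) =
      lp_covers P \<inter> {x. (x, y) \<in> lp_le P} \<times> {x. (x, y) \<in> lp_le P}"
    using down by (auto simp: lp_covers_def less) (auto simp: lp_less_iff)
qed

lemma saturated_chain_principal_ideal:
  assumes "labelled_poset P"
  shows "saturated_chain (principal_ideal P y) c \<longleftrightarrow>
    saturated_chain P c \<and> set c \<subseteq> {x. (x, y) \<in> lp_le P}"
proof -
  have "c ! i \<in> set c" "c ! Suc i \<in> set c" if "Suc i < length c" for i
    using that by auto
  then show ?thesis
    using labelled_posetD(2)[OF assms]
    unfolding saturated_chain_def principal_ideal_simps[OF assms]
    by (auto simp: subset_iff)
qed

lemma chain_label_principal_ideal:
  assumes "labelled_poset P" "saturated_chain (principal_ideal P y) c"
  shows "chain_label (principal_ideal P y) c = chain_label P c"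
  unfolding chain_label_def
proof (rule sum.cong)
  fix i assume "i \<in> {..<length c - 1}"
  then have "(c ! i, c ! Suc i) \<in> lp_covers (principal_ideal P y)"
    using assms(2) by (auto simp: saturated_chain_def)
  then show "lp_lab (principal_ideal P y) (c ! i, c ! Suc i) = lp_lab P (c ! i, c ! Suc i)"
    by (simp add: principal_ideal_simps[OF assms(1)])
qed simp

text \<open>If the chain starts at a nonminimal element or stops below y, one more cover extends it.
  Conversely, an extra element z of a larger chain is comparable with all of c; minimality of
  \<open>hd c\<close> puts z between the ends, so z was in c already. Maximality thus becomes a
  condition on the two ends.\<close>

lemma maximal_saturated_chain_principal_ideal:
  assumes "labelled_poset P" "y \<in> lp_elems P"
  shows "maximal_saturated_chain (principal_ideal P y) c \<longleftrightarrow>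
    saturated_chain P c \<and> lp_minimal P (hd c) \<and> last c = y"
proof
  assume max: "maximal_saturated_chain (principal_ideal P y) c"
  then have sat: "saturated_chain P c" and sub: "set c \<subseteq> {x. (x, y) \<in> lp_le P}"
    by (auto simp: maximal_saturated_chain_def saturated_chain_principal_ideal[OF assms(1)])
  have no: "\<not> set c \<subset> set d" if "saturated_chain P d" "set d \<subseteq> {x. (x, y) \<in> lp_le P}" for d
    using max that by (auto simp: maximal_saturated_chain_def saturated_chain_principal_ideal[OF assms(1)])
  have ne: "c \<noteq> []" using sat by (simp add: saturated_chain_iff)
  have hdc: "(hd c, y) \<in> lp_le P" "(last c, y) \<in> lp_le P"
    using sub hd_in_set[OF ne] last_in_set[OF ne] by auto
  have hdP: "hd c \<in> lp_elems P"
    using sat ne by (meson hd_in_set saturated_chain_iff subsetD)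
  have "lp_minimal P (hd c)"
  proof (rule ccontr)
    assume "\<not> lp_minimal P (hd c)"
    then obtain x where "(x, hd c) \<in> lp_less P"
      using hdP by (auto simp: lp_minimal_def)
    then obtain z where z: "(z, hd c) \<in> lp_covers P"
      using obtain_lower_cover[OF assms(1)] by metis
    then have zl: "(z, hd c) \<in> lp_less P" by (rule lp_covers_less)
    have "z \<notin> set c"
      using saturated_chain_hd_le_last[OF assms(1) sat, of z] zl labelled_posetD(5)[OF assms(1)]
      by (auto simp: lp_less_iff dest: antisymD)
    moreover have "saturated_chain P (z # c)"
      using z sat ne by (simp add: saturated_chain_Cons[OF assms(1)])
    moreover have "(z, y) \<in> lp_le P"
      using zl hdc labelled_posetD(4)[OF assms(1)] by (meson lp_less_iff transD)
    ultimately show False using no[of "z # c"] sub by auto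
  qed
  moreover have "last c = y"
  proof (rule ccontr)
    assume "last c \<noteq> y"
    then have "(last c, y) \<in> lp_less P" using hdc by (simp add: lp_less_iff)
    then obtain z where z: "(last c, z) \<in> lp_covers P" "(z, y) \<in> lp_le P"
      using obtain_upper_cover[OF assms(1)] by metis
    then have zl: "(last c, z) \<in> lp_less P" by (auto dest: lp_covers_less)
    have "z \<notin> set c"
      using saturated_chain_hd_le_last[OF assms(1) sat, of z] zl labelled_posetD(5)[OF assms(1)]
      by (auto simp: lp_less_iff dest: antisymD)
    moreover have "saturated_chain P (c @ [z])"
      using z sat ne by (simp add: saturated_chain_snoc[OF assms(1)])
    ultimately show False using no[of "c @ [z]"] sub z by auto
  qed
  ultimately show "saturated_chain P c \<and> lp_minimal P (hd c) \<and> last c = y" using sat by simp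
next
  assume "saturated_chain P c \<and> lp_minimal P (hd c) \<and> last c = y"
  then have sat: "saturated_chain P c" and min: "lp_minimal P (hd c)" and last: "last c = y" by auto
  show "maximal_saturated_chain (principal_ideal P y) c"
    unfolding maximal_saturated_chain_def saturated_chain_principal_ideal[OF assms(1)]
  proof (intro conjI sat notI)
    show "set c \<subseteq> {x. (x, y) \<in> lp_le P}"
      using saturated_chain_hd_le_last[OF assms(1) sat] last by auto
    assume "\<exists>d. (saturated_chain P d \<and> set d \<subseteq> {x. (x, y) \<in> lp_le P}) \<and> set c \<subset> set d"
    then obtain d z where d: "saturated_chain P d" "set d \<subseteq> {x. (x, y) \<in> lp_le P}" "set c \<subset> set d"
      and z: "z \<in> set d" "z \<notin> set c" by blast
    have comp: "(x, z) \<in> lp_le P \<or> (z, x) \<in> lp_le P" if "x \<in> set c" for x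
      using saturated_chain_comparable[OF assms(1) d(1), of x z] that d z by auto
    have "hd c \<in> set c" using sat by (auto simp: saturated_chain_iff)
    then have "(hd c, z) \<in> lp_le P"
      using comp[of "hd c"] min z by (auto simp: lp_minimal_def lp_less_iff)
    then have "z \<in> set c"
      using saturated_chain_mem_if_comparable[OF assms(1) sat comp] d z last by auto
    with z show False by simp
  qed
qed

lemma obtain_minimal_chain:
  assumes "labelled_poset P" "y \<in> lp_elems P"
  obtains c where "saturated_chain P c" "lp_minimal P (hd c)" "last c = y"
proof -
  have "\<exists>c. saturated_chain P c \<and> lp_minimal P (hd c) \<and> last c = y"
    using assms(2)
  proof (induction "card {z. (z, y) \<in> lp_less P}" arbitrary: y rule: less_induct)
    case less
    show ?case
    proof (cases "lp_minimal P y")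
      case True
      with less.prems have "saturated_chain P [y] \<and> lp_minimal P (hd [y]) \<and> last [y] = y"
        by (simp add: saturated_chain_iff)
      then show ?thesis by blast
    next
      case False
      then obtain x where "(x, y) \<in> lp_less P" using less.prems by (auto simp: lp_minimal_def)
      then obtain z where z: "(z, y) \<in> lp_covers P" using obtain_lower_cover[OF assms(1)] by metis
      then have zl: "(z, y) \<in> lp_less P" by (rule lp_covers_less)
      have "finite {z. (z, y) \<in> lp_less P}"
        by (rule finite_subset[OF _ labelled_posetD(1)[OF assms(1)]])
          (auto dest: lp_less_elems[OF assms(1)])
      moreover have "{x. (x, z) \<in> lp_less P} \<subset> {x. (x, y) \<in> lp_less P}"
      proof (rule psubsetI)
        show "{x. (x, z) \<in> lp_less P} \<subseteq> {x. (x, y) \<in> lp_less P}"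
          using zl by (auto intro: lp_less_trans[OF assms(1)])
        show "{x. (x, z) \<in> lp_less P} \<noteq> {x. (x, y) \<in> lp_less P}"
          using zl lp_less_irrefl[of z P] by (auto simp: set_eq_iff)
      qed
      ultimately have "card {x. (x, z) \<in> lp_less P} < card {z. (z, y) \<in> lp_less P}"
        by (rule psubset_card_mono)
      then obtain c where c: "saturated_chain P c" "lp_minimal P (hd c)" "last c = z"
        using less.hyps[of z] lp_less_elems[OF assms(1) zl] by auto
      then have "c \<noteq> []" by (simp add: saturated_chain_iff)
      then have "saturated_chain P (c @ [y]) \<and> lp_minimal P (hd (c @ [y])) \<and> last (c @ [y]) = y"
        using c z by (simp add: saturated_chain_snoc[OF assms(1)])
      then show ?thesis by blast
    qed
  qed
  then show thesis using that by blast
qed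

text \<open>A potential for the edge labelling. The next lemmas show that one exists iff the
  labelled poset is consistent and that it agrees with \<open>lp_rank\<close> on the ground set;
  afterwards ranks are handled through covers only.\<close>

definition rank_function :: "'a lposet \<Rightarrow> ('a \<Rightarrow> int) \<Rightarrow> bool" where
  "rank_function P \<rho> \<longleftrightarrow>
     (\<forall>x. lp_minimal P x \<longrightarrow> \<rho> x = 0) \<and> (\<forall>(p, q)\<in>lp_covers P. \<rho> q = \<rho> p + lp_lab P (p, q))"

lemma rank_function_covers:
  "rank_function P \<rho> \<Longrightarrow> (p, q) \<in> lp_covers P \<Longrightarrow> \<rho> q = \<rho> p + lp_lab P (p, q)"
  by (auto simp: rank_function_def)

lemma chain_label_rank_function:
  assumes "labelled_poset P" "rank_function P \<rho>" "saturated_chain P c"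
  shows "chain_label P c = \<rho> (last c) - \<rho> (hd c)"
  using assms(3)
proof (induction c rule: rev_induct)
  case (snoc q c)
  show ?case
  proof (cases "c = []")
    case False
    with snoc show ?thesis
      using rank_function_covers[OF assms(2), of "last c" q]
      by (simp add: saturated_chain_snoc[OF assms(1)] chain_label_snoc)
  qed (simp add: chain_label_def)
qed (simp add: saturated_chain_iff)

text \<open>Labels telescope along a chain, so every maximal chain of the ideal below y has label
  \<rho> y - 0. This is the way consistency of a newly built poset is established and its rank
  identified.\<close>

lemma eps_consistentI:
  assumes "labelled_poset P" "rank_function P \<rho>"
  shows "eps_consistent P" and "y \<in> lp_elems P \<Longrightarrow> lp_rank P y = \<rho> y"
proof -
  have lab: "chain_label (principal_ideal P y) c = \<rho> y"
    if "y \<in> lp_elems P" "maximal_saturated_chain (principal_ideal P y) c" for y c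
  proof -
    have "chain_label (principal_ideal P y) c = chain_label P c"
      using that by (auto simp: maximal_saturated_chain_def intro: chain_label_principal_ideal[OF assms(1)])
    also have "\<dots> = \<rho> y"
      using chain_label_rank_function[OF assms] that assms(2)
      by (simp add: maximal_saturated_chain_principal_ideal[OF assms(1)] rank_function_def)
    finally show ?thesis .
  qed
  show "eps_consistent P"
    unfolding eps_consistent_def eps_graded_def using assms(1) lab by auto
  assume y: "y \<in> lp_elems P"
  obtain c where "saturated_chain P c" "lp_minimal P (hd c)" "last c = y"
    using obtain_minimal_chain[OF assms(1) y] .
  then have "maximal_saturated_chain (principal_ideal P y) c"
    by (simp add: maximal_saturated_chain_principal_ideal[OF assms(1) y])
  then show "lp_rank P y = \<rho> y"
    unfolding lp_rank_def using lab[OF y] by (intro the_equality) auto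
qed

text \<open>A chain from a minimal element to p, extended by a cover of p by q, is again a chain
  from a minimal element and computes the rank of q; consistency makes the choice of chain
  irrelevant.\<close>

lemma rank_function_lp_rank:
  assumes "eps_consistent P"
  shows "rank_function P (lp_rank P)"
proof -
  have P: "labelled_poset P" using assms by (simp add: eps_consistent_def)
  have rank: "lp_rank P y = chain_label P c"
    if "saturated_chain P c" "lp_minimal P (hd c)" "last c = y" for y c
  proof -
    have y: "y \<in> lp_elems P" using that by (auto simp: saturated_chain_iff)
    have max: "maximal_saturated_chain (principal_ideal P y) c"
      using that by (simp add: maximal_saturated_chain_principal_ideal[OF P y])
    have "chain_label (principal_ideal P y) c = chain_label P c"
      using max by (auto simp: maximal_saturated_chain_def intro: chain_label_principal_ideal[OF P])
    moreover have uniq: "chain_label (principal_ideal P y) d = chain_label (principal_ideal P y) c"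
      if "maximal_saturated_chain (principal_ideal P y) d" for d
    proof -
      have "eps_graded (principal_ideal P y)" using assms y by (simp add: eps_consistent_def)
      then show ?thesis using that max unfolding eps_graded_def by blast
    qed
    have "lp_rank P y = chain_label (principal_ideal P y) c"
      unfolding lp_rank_def
    proof (rule the_equality)
      show "\<exists>d. maximal_saturated_chain (principal_ideal P y) d \<and>
          chain_label (principal_ideal P y) d = chain_label (principal_ideal P y) c"
        using max by (intro exI[of _ c]) simp
    qed (use uniq in auto)
    ultimately show ?thesis by simp
  qed
  show ?thesis
    unfolding rank_function_def
  proof (intro conjI allI impI ballI, safe)
    fix x assume "lp_minimal P x"
    then show "lp_rank P x = 0"
      using rank[of "[x]" x] by (simp add: saturated_chain_iff lp_minimal_def chain_label_def)
  next
    fix p q assume pq: "(p, q) \<in> lp_covers P"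
    then have "p \<in> lp_elems P" using lp_less_elems[OF P] lp_covers_less by metis
    then obtain c where c: "saturated_chain P c" "lp_minimal P (hd c)" "last c = p"
      using obtain_minimal_chain[OF P] by metis
    then have ne: "c \<noteq> []" by (simp add: saturated_chain_iff)
    have "saturated_chain P (c @ [q])"
      using c pq by (simp add: saturated_chain_snoc[OF P ne])
    then show "lp_rank P q = lp_rank P p + lp_lab P (p, q)"
      using rank[of "c @ [q]" q] rank[of c p] c ne by (simp add: chain_label_snoc)
  qed
qed

section \<open>Order polytopes via covering relations\<close>

text \<open>The local form of the inequalities of the order polytope: covers replace comparable
  pairs and covers labelled -1 replace nonascending pairs. The dilation factor m does not occur, so
  a point determines its saturation in the same way for every m.\<close>

definition edge_decreasing :: "'a lposet \<Rightarrow> ('a \<Rightarrow> 'b::linorder) \<Rightarrow> bool" where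
  "edge_decreasing P f \<longleftrightarrow>
     (\<forall>(p, q)\<in>lp_covers P. f q \<le> f p \<and> (lp_lab P (p, q) = -1 \<longrightarrow> f q < f p))"

lemma edge_decreasing_le:
  assumes "labelled_poset P" "edge_decreasing P f" "(p, q) \<in> lp_le P"
  shows "f q \<le> f p"
proof (cases "p = q")
  case False
  then have "(p, q) \<in> (lp_covers P)\<^sup>+"
    using assms by (simp add: trancl_lp_covers lp_less_iff)
  then show ?thesis
  proof induction
    case (step y z)
    then have "f z \<le> f y" using assms(2) by (auto simp: edge_decreasing_def)
    with step.IH show ?case by simp
  qed (use assms(2) in \<open>auto simp: edge_decreasing_def\<close>)
qed simp

text \<open>Some saturated chain from p to q has an edge with a label other than 1, hence -1. The
  function drops strictly along that edge and weakly before and after it.\<close>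

lemma edge_decreasing_nonascending:
  assumes "labelled_poset P" "edge_decreasing P f" "nonascending_pair P p q"
  shows "f q < f p"
proof -
  obtain c i where c: "saturated_chain P c" "hd c = p" "last c = q"
    and i: "Suc i < length c" "lp_lab P (c ! i, c ! Suc i) \<noteq> 1"
    using assms(3) by (auto simp: nonascending_pair_def ascending_pair_def)
  have cov: "(c ! i, c ! Suc i) \<in> lp_covers P"
    using c i by (simp add: saturated_chain_def)
  then have "f (c ! Suc i) < f (c ! i)"
    using lab_covers[OF assms(1) cov] i assms(2) by (auto simp: edge_decreasing_def)
  moreover have "(p, c ! i) \<in> lp_le P" "(c ! Suc i, q) \<in> lp_le P"
    using saturated_chain_hd_le_last[OF assms(1) c(1)] c i by auto
  then have "f (c ! i) \<le> f p" "f q \<le> f (c ! Suc i)"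
    by (auto intro: edge_decreasing_le[OF assms(1,2)])
  ultimately show ?thesis by simp
qed

lemma nonascending_cover:
  assumes "(p, q) \<in> lp_covers P" "lp_lab P (p, q) = -1" "labelled_poset P"
  shows "nonascending_pair P p q"
proof -
  have less: "(p, q) \<in> lp_less P"
    using assms(1) by (rule lp_covers_less)
  have "saturated_chain P [p, q]"
    using assms(1) lp_less_elems[OF assms(3) less] by (simp add: saturated_chain_iff)
  then have "\<not> ascending_pair P p q"
    using assms(2) by (auto simp: ascending_pair_def dest!: spec[of _ "[p, q]"] spec[of _ 0])
  with less show ?thesis by (simp add: nonascending_pair_def)
qed

text \<open>
  The separately defined case \<open>m = 0\<close> fits the same description: the zero function satisfies the
  strict inequalities iff no covering relation has label \<open>-1\<close>.
\<close>

lemma order_polytope_iff: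
  assumes "labelled_poset P"
  shows "f \<in> order_polytope m P \<longleftrightarrow> f \<in> lp_elems P \<rightarrow>\<^sub>E {0..real m} \<and> edge_decreasing P f"
proof (cases "m = 0")
  case True
  have range: "f \<in> lp_elems P \<rightarrow>\<^sub>E {0..real m} \<longleftrightarrow> f = (\<lambda>p\<in>lp_elems P. 0)"
    using True by (auto simp: PiE_iff fun_eq_iff extensional_def)
  have "p \<in> lp_elems P \<and> q \<in> lp_elems P" if "(p, q) \<in> lp_covers P" for p q
    using lp_less_elems[OF assms lp_covers_less[OF that]] .
  then have "edge_decreasing P (\<lambda>p\<in>lp_elems P. 0::real) \<longleftrightarrow> (\<forall>e\<in>lp_covers P. lp_lab P e \<noteq> -1)"
    by (auto simp: edge_decreasing_def)
  also have "\<dots> \<longleftrightarrow> (\<forall>e\<in>lp_covers P. lp_lab P e = 1)"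
    using lab_covers[OF assms] by fastforce
  finally show ?thesis
    using True range by (auto simp: order_polytope_def)
next
  case False
  have "edge_decreasing P f" if f: "\<forall>(p, q)\<in>lp_le P. f q \<le> f p"
    "\<forall>p q. nonascending_pair P p q \<longrightarrow> f q < f p"
    unfolding edge_decreasing_def
  proof clarify
    fix p q assume pq: "(p, q) \<in> lp_covers P"
    then have "(p, q) \<in> lp_le P" using lp_covers_less[OF pq] by (simp add: lp_less_iff)
    then show "f q \<le> f p \<and> (lp_lab P (p, q) = -1 \<longrightarrow> f q < f p)"
      using f nonascending_cover[OF pq _ assms] by auto
  qed
  then have "edge_decreasing P f \<longleftrightarrow>
      (\<forall>(p, q)\<in>lp_le P. f q \<le> f p) \<and> (\<forall>p q. nonascending_pair P p q \<longrightarrow> f q < f p)"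
    using edge_decreasing_le[OF assms, of f] edge_decreasing_nonascending[OF assms, of f] by blast
  then show ?thesis
    using False by (simp add: order_polytope_def)
qed

section \<open>The saturation determined by a point\<close>

text \<open>The order of Q contains that of P, so minimal elements of Q are minimal in P and have
  rank 0. With labels equal to rank differences, \<open>lp_rank P\<close> is therefore a rank
  function of Q, which yields both the consistency of Q and the equality of ranks.\<close>

lemma saturation_iff:
  assumes "eps_consistent P"
  shows "saturation P Q \<longleftrightarrow>
    labelled_poset Q \<and> lp_elems Q = lp_elems P \<and>
    (\<forall>x\<in>lp_elems P. \<forall>y\<in>lp_elems P. \<bar>lp_rank P y - lp_rank P x\<bar> = 1 \<longrightarrow>
      (x, y) \<in> lp_le Q \<or> (y, x) \<in> lp_le Q) \<and>
    lp_less P \<subseteq> lp_less Q \<and>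
    (\<forall>(p, q)\<in>lp_covers Q. lp_lab Q (p, q) = lp_rank P q - lp_rank P p)"
    (is "_ \<longleftrightarrow> ?R")
proof
  assume sat: "saturation P Q"
  then have Q: "labelled_poset Q" "eps_consistent Q"
    by (auto simp: saturation_def eps_consistent_def)
  have "lp_lab Q (p, q) = lp_rank P q - lp_rank P p" if "(p, q) \<in> lp_covers Q" for p q
    using rank_function_covers[OF rank_function_lp_rank[OF Q(2)] that]
      lp_less_elems[OF Q(1) lp_covers_less[OF that]] sat
    by (auto simp: saturation_def)
  then show ?R using sat Q by (auto simp: saturation_def)
next
  assume R: ?R
  have min: "lp_minimal P x" if "lp_minimal Q x" for x
    using that R by (auto simp: lp_minimal_def)
  have "rank_function Q (lp_rank P)"
    unfolding rank_function_def
  proof (intro conjI allI impI)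
    fix x assume "lp_minimal Q x"
    then show "lp_rank P x = 0"
      using min rank_function_lp_rank[OF assms] by (auto simp: rank_function_def)
  qed (use R in auto)
  note eps_consistentI[OF conjunct1[OF R] this]
  then show "saturation P Q"
    using R assms by (auto simp: saturation_def)
qed

text \<open>Of two elements whose ranks differ by one, exactly one orientation is a step: from lower
  to higher rank if the value does not increase that way, and the reverse otherwise. The asymmetry
  between weak and strict inequality mirrors the labels 1 and -1.\<close>

definition rank_steps :: "'a lposet \<Rightarrow> ('a \<Rightarrow> 'b::linorder) \<Rightarrow> ('a \<times> 'a) set" where
  "rank_steps P f =
     {(x, y) \<in> lp_elems P \<times> lp_elems P.
        lp_rank P y = lp_rank P x + 1 \<and> f y \<le> f x \<or> lp_rank P y = lp_rank P x - 1 \<and> f y < f x}"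

lemma rank_steps_trancl:
  assumes "(x, y) \<in> (rank_steps P f)\<^sup>+"
  shows "x \<in> lp_elems P" "y \<in> lp_elems P"
    and "f y < f x \<or> f y = f x \<and> lp_rank P x < lp_rank P y"
  using assms by (induction; force simp: rank_steps_def)+

text \<open>
  The labelling of the auxiliary poset defining \<open>C\<close> is a placeholder: covering relations depend on
  the order only.
\<close>

definition induced_saturation :: "'a lposet \<Rightarrow> ('a \<Rightarrow> 'b::linorder) \<Rightarrow> 'a lposet" where
  "induced_saturation P f =
     (let R = Id_on (lp_elems P) \<union> (rank_steps P f)\<^sup>+;
          C = lp_covers \<lparr>lp_elems = lp_elems P, lp_le = R, lp_lab = lp_lab P\<rparr> in
      \<lparr>lp_elems = lp_elems P, lp_le = R, lp_lab = (\<lambda>(p, q)\<in>C. lp_rank P q - lp_rank P p)\<rparr>)"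

lemma lp_covers_cong: "lp_le P = lp_le Q \<Longrightarrow> lp_covers P = lp_covers Q"
  by (simp add: lp_covers_def lp_less_def)

lemma induced_saturation_simps:
  shows "lp_elems (induced_saturation P f) = lp_elems P"
    and "lp_le (induced_saturation P f) = Id_on (lp_elems P) \<union> (rank_steps P f)\<^sup>+"
    and "lp_lab (induced_saturation P f) =
      (\<lambda>(p, q)\<in>lp_covers (induced_saturation P f). lp_rank P q - lp_rank P p)"
    and "lp_less (induced_saturation P f) = (rank_steps P f)\<^sup>+"
proof -
  show el: "lp_elems (induced_saturation P f) = lp_elems P"
    and le: "lp_le (induced_saturation P f) = Id_on (lp_elems P) \<union> (rank_steps P f)\<^sup>+"
    by (simp_all add: induced_saturation_def Let_def)
  show "lp_lab (induced_saturation P f) =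
      (\<lambda>(p, q)\<in>lp_covers (induced_saturation P f). lp_rank P q - lp_rank P p)"
    unfolding induced_saturation_def Let_def
    by (simp, rule arg_cong2[where f=restrict, OF refl lp_covers_cong], simp)
  have "(x, x) \<notin> (rank_steps P f)\<^sup>+" for x
    using rank_steps_trancl(3)[of x x P f] by auto
  then show "lp_less (induced_saturation P f) = (rank_steps P f)\<^sup>+"
    by (auto simp: lp_less_def le)
qed

text \<open>A path of two or more steps passes through an intermediate element, so only a single
  step can be a cover. Hence ranks change by exactly one along covers and the labels are indeed 1 or
  -1.\<close>

lemma covers_induced_saturation: "lp_covers (induced_saturation P f) \<subseteq> rank_steps P f"
proof clarify
  fix x y assume xy: "(x, y) \<in> lp_covers (induced_saturation P f)"
  then have "(x, y) \<in> (rank_steps P f)\<^sup>+"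
    by (auto dest: lp_covers_less simp: induced_saturation_simps)
  then show "(x, y) \<in> rank_steps P f"
  proof (cases rule: trancl.cases)
    case (trancl_into_trancl z)
    then have "(z, y) \<in> (rank_steps P f)\<^sup>+" by auto
    with trancl_into_trancl xy show ?thesis
      by (auto simp: lp_covers_def induced_saturation_simps)
  qed
qed

lemma labelled_poset_induced_saturation:
  assumes "finite (lp_elems P)"
  shows "labelled_poset (induced_saturation P f)"
proof -
  have "antisym ((rank_steps P f)\<^sup>+)"
  proof (rule antisymI)
    fix x y assume "(x, y) \<in> (rank_steps P f)\<^sup>+" "(y, x) \<in> (rank_steps P f)\<^sup>+"
    from this[THEN rank_steps_trancl(3)] show "x = y" by auto
  qed
  moreover have "lp_lab (induced_saturation P f) \<in> lp_covers (induced_saturation P f) \<rightarrow>\<^sub>E {-1, 1}"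
    unfolding induced_saturation_simps(3)[of P f]
    using covers_induced_saturation[of P f] by (auto simp: rank_steps_def)
  moreover have "trans (Id_on (lp_elems P) \<union> (rank_steps P f)\<^sup>+)"
    by (rule transI) (auto intro: trancl_trans)
  ultimately show ?thesis
    using assms rank_steps_trancl(1,2)[of _ _ P f]
    unfolding labelled_poset_def partial_order_on_def preorder_on_def refl_on_def
      induced_saturation_simps(1,2)
    by (auto simp: antisym_def)
qed

text \<open>The label of a cover of P is its rank difference, so the two clauses of
  \<open>edge_decreasing\<close> match the two kinds of steps. This places the order of P inside
  that of the induced saturation.\<close>

lemma covers_subset_rank_steps:
  assumes "eps_consistent P" "edge_decreasing P f"
  shows "lp_covers P \<subseteq> rank_steps P f"
proof clarify
  fix x y assume xy: "(x, y) \<in> lp_covers P"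
  have P: "labelled_poset P" using assms by (simp add: eps_consistent_def)
  show "(x, y) \<in> rank_steps P f"
    using rank_function_covers[OF rank_function_lp_rank[OF assms(1)] xy]
      lab_covers[OF P xy] lp_less_elems[OF P lp_covers_less[OF xy]] assms(2) xy
    by (auto simp: rank_steps_def edge_decreasing_def)
qed

lemma saturation_induced_saturation:
  assumes "eps_consistent P" "edge_decreasing P f"
  shows "saturation P (induced_saturation P f)" "edge_decreasing (induced_saturation P f) f"
proof -
  have P: "labelled_poset P" using assms by (simp add: eps_consistent_def)
  let ?Q = "induced_saturation P f"
  have lab: "lp_lab ?Q (p, q) = lp_rank P q - lp_rank P p" if "(p, q) \<in> lp_covers ?Q" for p q
    using that by (simp add: induced_saturation_simps(3))
  have "(x, y) \<in> lp_le ?Q \<or> (y, x) \<in> lp_le ?Q"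
    if "x \<in> lp_elems P" "y \<in> lp_elems P" "\<bar>lp_rank P y - lp_rank P x\<bar> = 1" for x y
  proof -
    have "(x, y) \<in> rank_steps P f \<or> (y, x) \<in> rank_steps P f"
      using that by (auto simp: rank_steps_def)
    then show ?thesis by (auto simp: induced_saturation_simps)
  qed
  moreover have "(lp_covers P)\<^sup>+ \<subseteq> (rank_steps P f)\<^sup>+"
    by (rule trancl_mono_subset) (rule covers_subset_rank_steps[OF assms])
  then have "lp_less P \<subseteq> lp_less ?Q"
    by (simp add: trancl_lp_covers[OF P] induced_saturation_simps)
  ultimately show "saturation P ?Q"
    unfolding saturation_iff[OF assms(1)]
    using labelled_poset_induced_saturation[OF labelled_posetD(1)[OF P]] lab
    by (auto simp: induced_saturation_simps(1))
  show "edge_decreasing ?Q f"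
    unfolding edge_decreasing_def
  proof clarify
    fix p q assume pq: "(p, q) \<in> lp_covers ?Q"
    then show "f q \<le> f p \<and> (lp_lab ?Q (p, q) = -1 \<longrightarrow> f q < f p)"
      using covers_induced_saturation[of P f] lab[OF pq] by (auto simp: rank_steps_def)
  qed
qed

lemma saturation_unique:
  assumes "saturation P Q" "edge_decreasing Q f"
  shows "Q = induced_saturation P f" "edge_decreasing P f"
proof -
  have cons: "eps_consistent P" using assms by (simp add: saturation_def)
  have P: "labelled_poset P" using cons by (simp add: eps_consistent_def)
  note Q = assms(1)[unfolded saturation_iff[OF cons]]
  then have lQ: "labelled_poset Q" by simp
  have lab: "lp_lab Q (p, q) = lp_rank P q - lp_rank P p" if "(p, q) \<in> lp_covers Q" for p q
    using Q that by auto
  have cov: "lp_covers Q \<subseteq> rank_steps P f"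
  proof clarify
    fix x y assume xy: "(x, y) \<in> lp_covers Q"
    then show "(x, y) \<in> rank_steps P f"
      using lab[OF xy] lab_covers[OF lQ xy] lp_less_elems[OF lQ lp_covers_less[OF xy]] assms(2) Q
      by (auto simp: rank_steps_def edge_decreasing_def)
  qed
  then have sub: "lp_less Q \<subseteq> (rank_steps P f)\<^sup>+"
    using trancl_mono_subset trancl_lp_covers[OF lQ] by metis
  have "rank_steps P f \<subseteq> lp_less Q"
  proof clarify
    fix x y assume xy: "(x, y) \<in> rank_steps P f"
    then have "x \<in> lp_elems P" "y \<in> lp_elems P" "\<bar>lp_rank P y - lp_rank P x\<bar> = 1" "x \<noteq> y"
      by (auto simp: rank_steps_def)
    then have "(x, y) \<in> lp_le Q \<or> (y, x) \<in> lp_le Q" and "x \<noteq> y"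
      using Q by blast+
    \<comment> \<open>Otherwise (y, x) would be a path of steps, and with the step (x, y) it would
      close a cycle, against the lexicographic descent along steps.\<close>
    moreover have "(y, x) \<notin> lp_less Q"
      using xy sub rank_steps_trancl(3)[of y x P f] rank_steps_trancl(3)[of x y P f] by fastforce
    ultimately show "(x, y) \<in> lp_less Q" by (auto simp: lp_less_iff)
  qed
  then have "(rank_steps P f)\<^sup>+ \<subseteq> (lp_less Q)\<^sup>+"
    by (rule trancl_mono_subset)
  then have less: "lp_less Q = (rank_steps P f)\<^sup>+"
    using sub trancl_id[OF trans_lp_less[OF lQ]] by auto
  have "lp_le Q = Id_on (lp_elems P) \<union> (rank_steps P f)\<^sup>+"
    using lp_le_iff[OF lQ] Q less by auto
  then have le: "lp_le Q = lp_le (induced_saturation P f)"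
    by (simp add: induced_saturation_simps)
  then have cov_eq: "lp_covers Q = lp_covers (induced_saturation P f)"
    by (rule lp_covers_cong)
  have "lp_lab Q = lp_lab (induced_saturation P f)"
  proof
    fix e
    show "lp_lab Q e = lp_lab (induced_saturation P f) e"
      using lab labelled_posetD(6)[OF lQ]
      by (cases e) (auto simp: induced_saturation_simps(3) cov_eq PiE_def extensional_def)
  qed
  then show "Q = induced_saturation P f"
    using le Q by (auto intro!: lposet.equality simp: induced_saturation_simps(1))
  show "edge_decreasing P f"
    unfolding edge_decreasing_def
  proof clarify
    fix p q assume pq: "(p, q) \<in> lp_covers P"
    then have "(p, q) \<in> (rank_steps P f)\<^sup>+"
      using lp_covers_less[OF pq] Q less by auto
    \<comment> \<open>A path of steps either lowers f or keeps f and raises the rank. Label -1 means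
      that the rank falls, which excludes the second alternative.\<close>
    then show "f q \<le> f p \<and> (lp_lab P (p, q) = -1 \<longrightarrow> f q < f p)"
      using rank_steps_trancl(3)[of p q P f]
        rank_function_covers[OF rank_function_lp_rank[OF cons] pq] by auto
  qed
qed

section \<open>The action on labelled posets\<close>

lemma lposet_eqI:
  assumes "labelled_poset P" "labelled_poset Q" "lp_elems P = lp_elems Q" "lp_le P = lp_le Q"
    and "\<And>e. e \<in> lp_covers Q \<Longrightarrow> lp_lab P e = lp_lab Q e"
  shows "P = Q"
proof -
  have "lp_lab P = lp_lab Q"
    using labelled_posetD(6)[OF assms(1)] labelled_posetD(6)[OF assms(2)] assms(5)
    by (intro PiE_ext) (simp_all add: lp_covers_cong[OF assms(4)])
  then show ?thesis using assms by (intro lposet.equality) auto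
qed

lemma Bij_simps:
  assumes g: "g \<in> Bij X"
  shows "x \<in> X \<Longrightarrow> g x \<in> X" "x \<in> X \<Longrightarrow> inv_into X g x \<in> X"
    and "x \<in> X \<Longrightarrow> inv_into X g (g x) = x" "x \<in> X \<Longrightarrow> g (inv_into X g x) = x"
    and "x \<in> X \<Longrightarrow> y \<in> X \<Longrightarrow> g x = g y \<longleftrightarrow> x = y"
  using g by (auto simp: Bij_def bij_betw_def inj_on_eq_iff f_inv_into_f inv_into_into)

text \<open>\<open>lp_act\<close> pulls relations back along the inverse of g. Rewritten as an image
  under g in both coordinates, they can be composed and compared without inverses.\<close>

lemma pull_pairs:
  assumes "g \<in> Bij X" "R \<subseteq> X \<times> X"
  shows "{(x, y) \<in> X \<times> X. (inv_into X g x, inv_into X g y) \<in> R} = map_prod g g ` R"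
proof (safe)
  fix x y assume "x \<in> X" "y \<in> X" "(inv_into X g x, inv_into X g y) \<in> R"
  then show "(x, y) \<in> map_prod g g ` R"
    by (intro rev_image_eqI[of "(inv_into X g x, inv_into X g y)"]) (auto simp: Bij_simps[OF assms(1)])
qed (use assms(2) in \<open>auto simp: Bij_simps[OF assms(1)]\<close>)

section \<open>Transport of a labelled poset along a bijection of its ground set\<close>

context
  fixes Q :: "'a lposet" and X :: "'a set" and g :: "'a \<Rightarrow> 'a"
  assumes Q: "labelled_poset Q" and X: "lp_elems Q = X" and g: "g \<in> Bij X"
begin

lemma lp_elems_act: "lp_elems (lp_act g Q) = X"
  by (simp add: lp_act_def Let_def X)

lemma lp_le_act: "lp_le (lp_act g Q) = map_prod g g ` lp_le Q"
  using pull_pairs[OF g, of "lp_le Q"] labelled_posetD(2)[OF Q] by (simp add: lp_act_def Let_def X)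

lemma lp_less_act: "lp_less (lp_act g Q) = map_prod g g ` lp_less Q"
proof -
  have "inj_on (map_prod g g) (X \<times> X)"
    by (rule inj_onI) (auto simp: Bij_simps[OF g])
  moreover have "map_prod g g ` (X \<times> X \<inter> Id) = map_prod g g ` (X \<times> X) \<inter> Id"
    by (auto simp: Bij_simps[OF g] intro!: rev_image_eqI)
  ultimately show ?thesis
    using labelled_posetD(2)[OF Q] unfolding lp_less_def lp_le_act X
    by (auto simp: Bij_simps[OF g] subset_iff image_iff)
qed

lemma lp_covers_subset: "lp_covers Q \<subseteq> X \<times> X"
  using lp_less_elems[OF Q] X by (auto dest!: lp_covers_less)

lemma lp_less_act_iff:
  "x \<in> X \<Longrightarrow> y \<in> X \<Longrightarrow> (g x, g y) \<in> lp_less (lp_act g Q) \<longleftrightarrow> (x, y) \<in> lp_less Q"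
  using lp_less_elems[OF Q] unfolding lp_less_act by (auto simp: X Bij_simps[OF g])

lemma lp_covers_act: "lp_covers (lp_act g Q) = map_prod g g ` lp_covers Q"
proof (rule equalityI; rule subsetI)
  fix e assume "e \<in> lp_covers (lp_act g Q)"
  then obtain x y where e: "e = (g x, g y)" "(x, y) \<in> lp_less Q"
    and no: "\<And>z. \<not> ((g x, z) \<in> lp_less (lp_act g Q) \<and> (z, g y) \<in> lp_less (lp_act g Q))"
    by (auto simp: lp_covers_def lp_less_act)
  have "\<not> ((x, z) \<in> lp_less Q \<and> (z, y) \<in> lp_less Q)" for z
    using no[of "g z"] by (auto simp: lp_less_act)
  with e show "e \<in> map_prod g g ` lp_covers Q" by (auto simp: lp_covers_def)
next
  fix e assume "e \<in> map_prod g g ` lp_covers Q"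
  then obtain x y where e: "e = (g x, g y)" "(x, y) \<in> lp_less Q"
    and no: "\<And>z. \<not> ((x, z) \<in> lp_less Q \<and> (z, y) \<in> lp_less Q)"
    by (auto simp: lp_covers_def)
  have xy: "x \<in> X" "y \<in> X" using lp_less_elems[OF Q e(2)] X by auto
  have "\<not> ((g x, z) \<in> lp_less (lp_act g Q) \<and> (z, g y) \<in> lp_less (lp_act g Q))" for z
  proof (cases "z \<in> X")
    case True
    then show ?thesis
      using no[of "inv_into X g z"] xy lp_less_act_iff[of x "inv_into X g z"]
        lp_less_act_iff[of "inv_into X g z" y] by (simp add: Bij_simps[OF g])
  next
    case False
    then show ?thesis
      using lp_less_elems[OF Q] by (auto simp: lp_less_act X Bij_simps[OF g])
  qed
  with e show "e \<in> lp_covers (lp_act g Q)"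
    using xy by (auto simp: lp_covers_def lp_less_act_iff)
qed

lemma lp_lab_act:
  assumes "(x, y) \<in> lp_covers Q"
  shows "lp_lab (lp_act g Q) (g x, g y) = lp_lab Q (x, y)"
  using assms lp_covers_subset by (auto simp: lp_act_def Let_def X Bij_simps[OF g])

lemma labelled_poset_act: "labelled_poset (lp_act g Q)"
proof -
  have le: "lp_le Q \<subseteq> X \<times> X" using labelled_posetD(2)[OF Q] X by simp
  have "trans (map_prod g g ` lp_le Q)"
  proof (rule transI, safe)
    fix a b c d assume *: "(a, b) \<in> lp_le Q" "(c, d) \<in> lp_le Q" "g b = g c"
    then have "b = c" using le Bij_simps(5)[OF g, of b c] by blast
    with * have "(a, d) \<in> lp_le Q" using labelled_posetD(4)[OF Q] by (meson transD)
    then show "(g a, g d) \<in> map_prod g g ` lp_le Q" by force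
  qed
  moreover have "antisym (map_prod g g ` lp_le Q)"
  proof (rule antisymI)
    fix x y assume "(x, y) \<in> map_prod g g ` lp_le Q" "(y, x) \<in> map_prod g g ` lp_le Q"
    then obtain a b c d where *: "(a, b) \<in> lp_le Q" "(c, d) \<in> lp_le Q"
      and xy: "x = g a" "y = g b" "y = g c" "x = g d" by auto
    then have "b = c" "a = d" using le Bij_simps(5)[OF g, of b c] Bij_simps(5)[OF g, of a d] by blast+
    with * have "a = b" using labelled_posetD(5)[OF Q] by (auto dest: antisymD)
    with xy show "x = y" by simp
  qed
  moreover have "(x, x) \<in> map_prod g g ` lp_le Q" if "x \<in> X" for x
    using that labelled_posetD(3)[OF Q, of "inv_into X g x"] X
    by (intro rev_image_eqI[of "(inv_into X g x, inv_into X g x)"]) (auto simp: Bij_simps[OF g])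
  moreover have "lp_lab (lp_act g Q) \<in> map_prod g g ` lp_covers Q \<rightarrow>\<^sub>E {-1, 1}"
  proof -
    have "lp_lab (lp_act g Q) \<in> extensional (map_prod g g ` lp_covers Q)"
      using pull_pairs[OF g lp_covers_subset] by (simp add: lp_act_def Let_def X)
    moreover have "lp_lab (lp_act g Q) e \<in> {-1, 1}" if e: "e \<in> map_prod g g ` lp_covers Q" for e
    proof -
      obtain x y where "(x, y) \<in> lp_covers Q" "e = (g x, g y)" using e by auto
      then show ?thesis using lab_covers[OF Q, of "(x, y)"] lp_lab_act[of x y] by simp
    qed
    ultimately show ?thesis by (auto simp: PiE_iff)
  qed
  moreover have "map_prod g g ` lp_le Q \<subseteq> X \<times> X"
    using le Bij_simps(1)[OF g] by auto
  moreover have "finite X" using labelled_posetD(1)[OF Q] X by simp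
  ultimately show ?thesis
    unfolding labelled_poset_def partial_order_on_def preorder_on_def refl_on_def
      lp_elems_act lp_le_act lp_covers_act by blast
qed

lemma edge_decreasing_act: "edge_decreasing (lp_act g Q) f \<longleftrightarrow> edge_decreasing Q (\<lambda>x. f (g x))"
proof -
  have "edge_decreasing (lp_act g Q) f \<longleftrightarrow>
      (\<forall>(p, q)\<in>lp_covers Q. f (g q) \<le> f (g p) \<and>
        (lp_lab (lp_act g Q) (g p, g q) = -1 \<longrightarrow> f (g q) < f (g p)))"
    by (simp add: edge_decreasing_def lp_covers_act split_beta map_prod_def)
  also have "\<dots> \<longleftrightarrow> edge_decreasing Q (\<lambda>x. f (g x))"
    unfolding edge_decreasing_def by (intro ball_cong) (auto simp: lp_lab_act)
  finally show ?thesis .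
qed

end

section \<open>Group law of the transport, automorphism groups and stabilizers\<close>

lemma lp_act_compose:
  assumes Q: "labelled_poset Q" and X: "lp_elems Q = X" and g: "g \<in> Bij X" and k: "k \<in> Bij X"
  shows "lp_act g (lp_act k Q) = lp_act (compose X g k) Q"
proof -
  note k_act = labelled_poset_act[OF Q X k] lp_elems_act[OF Q X k]
  note gk = compose_Bij[OF g k]
  have img: "map_prod g g ` map_prod k k ` R = map_prod (compose X g k) (compose X g k) ` R"
    if "R \<subseteq> X \<times> X" for R
    using that unfolding image_image by (intro image_cong) (auto simp: compose_def)
  show ?thesis
  proof (rule lposet_eqI)
    show "labelled_poset (lp_act g (lp_act k Q))" "labelled_poset (lp_act (compose X g k) Q)"
      using labelled_poset_act[OF k_act g] labelled_poset_act[OF Q X gk] .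
    show "lp_elems (lp_act g (lp_act k Q)) = lp_elems (lp_act (compose X g k) Q)"
      using lp_elems_act[OF k_act g] lp_elems_act[OF Q X gk] by simp
    show "lp_le (lp_act g (lp_act k Q)) = lp_le (lp_act (compose X g k) Q)"
      using lp_le_act[OF k_act g] lp_le_act[OF Q X gk] lp_le_act[OF Q X k] labelled_posetD(2)[OF Q] X
      by (simp add: img)
    fix e assume "e \<in> lp_covers (lp_act (compose X g k) Q)"
    then obtain x y where xy: "(x, y) \<in> lp_covers Q" and e: "e = (compose X g k x, compose X g k y)"
      using lp_covers_act[OF Q X gk] by auto
    have "x \<in> X" "y \<in> X" using lp_covers_subset[OF Q X k] xy by auto
    then have e': "e = (g (k x), g (k y))" using e by (simp add: compose_def)
    have kxy: "(k x, k y) \<in> lp_covers (lp_act k Q)"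
      using xy lp_covers_act[OF Q X k] by force
    show "lp_lab (lp_act g (lp_act k Q)) e = lp_lab (lp_act (compose X g k) Q) e"
      using lp_lab_act[OF k_act g kxy] lp_lab_act[OF Q X k xy] lp_lab_act[OF Q X gk xy] e e' by simp
  qed
qed

lemma lp_act_one:
  assumes Q: "labelled_poset Q" and X: "lp_elems Q = X"
  shows "lp_act (\<lambda>x\<in>X. x) Q = Q"
proof -
  note act = Q X id_Bij[of X]
  have img: "map_prod (\<lambda>x\<in>X. x) (\<lambda>x\<in>X. x) ` R = R" if "R \<subseteq> X \<times> X" for R
    using that by (force simp: image_iff)
  have sub: "lp_le Q \<subseteq> X \<times> X" "lp_covers Q \<subseteq> X \<times> X"
    using labelled_posetD(2)[OF Q] lp_covers_subset[OF act] X by auto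
  show ?thesis
  proof (rule lposet_eqI)
    fix e assume e: "e \<in> lp_covers Q"
    obtain x y where xy: "e = (x, y)" by (cases e)
    with e sub have "x \<in> X" "y \<in> X" by auto
    then show "lp_lab (lp_act (\<lambda>x\<in>X. x) Q) e = lp_lab Q e"
      using lp_lab_act[OF act, of x y] e xy by simp
  qed (simp_all add: labelled_poset_act[OF act] Q lp_elems_act[OF act] X lp_le_act[OF act] img[OF sub(1)])
qed

text \<open>This presents the automorphism group as the stabilizer of P in the symmetric group of
  the ground set. The subgroup property and the inclusion of a stabilizer of Q into Aut(Q) both come
  from this description.\<close>

lemma lp_aut_iff:
  assumes P: "labelled_poset P"
  shows "g \<in> lp_aut P \<longleftrightarrow> g \<in> Bij (lp_elems P) \<and> lp_act g P = P"
proof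
  assume "g \<in> lp_aut P"
  then have g: "g \<in> Bij (lp_elems P)"
    and le: "\<And>p q. p \<in> lp_elems P \<Longrightarrow> q \<in> lp_elems P \<Longrightarrow> (g p, g q) \<in> lp_le P \<longleftrightarrow> (p, q) \<in> lp_le P"
    and lab: "\<And>p q. (p, q) \<in> lp_covers P \<Longrightarrow> lp_lab P (g p, g q) = lp_lab P (p, q)"
    by (auto simp: lp_aut_def)
  note act = P refl g
  have "lp_le (lp_act g P) = lp_le P"
  proof -
    have "lp_le (lp_act g P) = {(x, y) \<in> lp_elems P \<times> lp_elems P.
        (inv_into (lp_elems P) g x, inv_into (lp_elems P) g y) \<in> lp_le P}"
      by (simp add: lp_act_def Let_def)
    also have "\<dots> = {(x, y) \<in> lp_elems P \<times> lp_elems P. (x, y) \<in> lp_le P}"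
    proof -
      have "(inv_into (lp_elems P) g x, inv_into (lp_elems P) g y) \<in> lp_le P \<longleftrightarrow> (x, y) \<in> lp_le P"
        if "x \<in> lp_elems P" "y \<in> lp_elems P" for x y
        using le[of "inv_into (lp_elems P) g x" "inv_into (lp_elems P) g y"] that
        by (simp add: Bij_simps[OF g])
      then show ?thesis by auto
    qed
    also have "\<dots> = lp_le P" using labelled_posetD(2)[OF P] by auto
    finally show ?thesis .
  qed
  moreover have "lp_lab (lp_act g P) e = lp_lab P e" if "e \<in> lp_covers P" for e
  proof -
    have "e \<in> map_prod g g ` lp_covers P"
      using that lp_covers_act[OF act] lp_covers_cong[OF calculation] by simp
    then show ?thesis using lp_lab_act[OF act] lab by auto
  qed
  ultimately have "lp_act g P = P"
    by (intro lposet_eqI) (simp_all add: labelled_poset_act[OF act] P lp_elems_act[OF act])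
  with g show "g \<in> Bij (lp_elems P) \<and> lp_act g P = P" by simp
next
  assume R: "g \<in> Bij (lp_elems P) \<and> lp_act g P = P"
  then have g: "g \<in> Bij (lp_elems P)" and eq: "lp_act g P = P" by auto
  note act = P refl g
  have "(g p, g q) \<in> lp_le P \<longleftrightarrow> (p, q) \<in> lp_le P" if "p \<in> lp_elems P" "q \<in> lp_elems P" for p q
    using lp_less_act_iff[OF act that] that
    by (auto simp: eq lp_le_iff[OF P] Bij_simps[OF g])
  moreover have "lp_lab P (g p, g q) = lp_lab P (p, q)" if "(p, q) \<in> lp_covers P" for p q
    using lp_lab_act[OF act that] by (simp add: eq)
  ultimately show "g \<in> lp_aut P" using g by (auto simp: lp_aut_def)
qed

lemma BijGroup_simps:
  shows "carrier (BijGroup X) = Bij X" "one (BijGroup X) = (\<lambda>x\<in>X. x)"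
    and "g \<in> Bij X \<Longrightarrow> h \<in> Bij X \<Longrightarrow> mult (BijGroup X) g h = compose X g h"
  by (simp_all add: BijGroup_def)

lemma lp_act_mult:
  assumes "labelled_poset Q" "lp_elems Q = X" "g \<in> Bij X" "h \<in> Bij X"
  shows "lp_act (g \<otimes>\<^bsub>BijGroup X\<^esub> h) Q = lp_act g (lp_act h Q)"
  using lp_act_compose[OF assms] assms by (simp add: BijGroup_simps)

text \<open>Applied with the full symmetric group it yields automorphism groups, with the acting
  group it yields the stabilizers of saturations.\<close>

lemma subgroup_fixing_lposet:
  assumes "labelled_poset Q" "lp_elems Q = X" "subgroup H (BijGroup X)"
  shows "subgroup {g \<in> H. lp_act g Q = Q} (BijGroup X)"
proof -
  interpret group "BijGroup X" by (rule group_BijGroup)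
  interpret subgroup H "BijGroup X" by fact
  have Bij: "g \<in> Bij X" if "g \<in> H" for g using subset that by (auto simp: BijGroup_simps)
  show ?thesis
  proof (rule subgroupI)
    show "{g \<in> H. lp_act g Q = Q} \<subseteq> carrier (BijGroup X)" using subset by auto
    show "{g \<in> H. lp_act g Q = Q} \<noteq> {}"
      using lp_act_one[OF assms(1,2)] one_closed by (auto simp: BijGroup_simps)
  next
    fix g assume g: "g \<in> {g \<in> H. lp_act g Q = Q}"
    then have gi: "inv\<^bsub>BijGroup X\<^esub> g \<in> H" by auto
    have "lp_act (inv\<^bsub>BijGroup X\<^esub> g) (lp_act g Q) = lp_act (inv\<^bsub>BijGroup X\<^esub> g \<otimes>\<^bsub>BijGroup X\<^esub> g) Q"
      using g gi by (intro lp_act_mult[OF assms(1,2), symmetric] Bij) auto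
    also have "inv\<^bsub>BijGroup X\<^esub> g \<otimes>\<^bsub>BijGroup X\<^esub> g = (\<lambda>x\<in>X. x)"
      using g l_inv[OF mem_carrier] by (simp add: BijGroup_simps(2))
    also have "lp_act (\<lambda>x\<in>X. x) Q = Q" by (rule lp_act_one[OF assms(1,2)])
    finally show "inv\<^bsub>BijGroup X\<^esub> g \<in> {g \<in> H. lp_act g Q = Q}" using g gi by simp
  next
    fix g h assume "g \<in> {g \<in> H. lp_act g Q = Q}" "h \<in> {g \<in> H. lp_act g Q = Q}"
    then show "g \<otimes>\<^bsub>BijGroup X\<^esub> h \<in> {g \<in> H. lp_act g Q = Q}"
      using lp_act_mult[OF assms(1,2)] Bij by simp
  qed
qed

lemma subgroup_lp_aut:
  assumes "labelled_poset P"
  shows "subgroup (lp_aut P) (BijGroup (lp_elems P))"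
proof -
  have "lp_aut P = {g \<in> Bij (lp_elems P). lp_act g P = P}"
    using lp_aut_iff[OF assms] by auto
  then show ?thesis
    using subgroup_fixing_lposet[OF assms refl group.subgroup_self[OF group_BijGroup]]
    by (simp add: BijGroup_simps)
qed

text \<open>An automorphism preserves minimal elements, covers and labels, so the rank composed with
  g is again a rank function, and rank functions agree on the ground set.\<close>

lemma lp_rank_aut:
  assumes "eps_consistent P" "g \<in> lp_aut P" "x \<in> lp_elems P"
  shows "lp_rank P (g x) = lp_rank P x"
proof -
  have P: "labelled_poset P" using assms by (simp add: eps_consistent_def)
  have g: "g \<in> Bij (lp_elems P)" and eq: "lp_act g P = P"
    using assms lp_aut_iff[OF P] by auto
  note act = P refl g
  note rk = rank_function_lp_rank[OF assms(1)]
  have "rank_function P (\<lambda>x. lp_rank P (g x))"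
    unfolding rank_function_def
  proof (intro conjI allI impI ballI, safe)
    fix x assume x: "lp_minimal P x"
    have "(z, g x) \<notin> lp_less P" for z
    proof
      assume z: "(z, g x) \<in> lp_less P"
      then have zP: "z \<in> lp_elems P" using lp_less_elems[OF P] by auto
      then have "(inv_into (lp_elems P) g z, x) \<in> lp_less P"
        using lp_less_act_iff[OF act, of "inv_into (lp_elems P) g z" x] z x
        by (simp add: eq Bij_simps[OF g] lp_minimal_def)
      with x show False by (simp add: lp_minimal_def)
    qed
    then have "lp_minimal P (g x)" using x by (simp add: lp_minimal_def Bij_simps[OF g])
    then show "lp_rank P (g x) = 0" using rk by (simp add: rank_function_def)
  next
    fix p q assume pq: "(p, q) \<in> lp_covers P"
    then have "(g p, g q) \<in> lp_covers P" using lp_covers_act[OF act] by (force simp: eq)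
    then show "lp_rank P (g q) = lp_rank P (g p) + lp_lab P (p, q)"
      using rank_function_covers[OF rk] lp_lab_act[OF act pq] by (simp add: eq)
  qed
  then show ?thesis using eps_consistentI(2)[OF P] assms(3) by simp
qed

lemma saturationD:
  assumes "saturation P Q"
  shows "labelled_poset Q" "lp_elems Q = lp_elems P"
  using assms by (auto simp: saturation_def eps_consistent_def)

text \<open>Relative to Q, the conditions involve only the order and the rank of P, and an
  automorphism of P leaves both invariant.\<close>

lemma saturation_act:
  assumes "saturation P Q" "g \<in> lp_aut P"
  shows "saturation P (lp_act g Q)"
proof -
  have cons: "eps_consistent P" using assms by (simp add: saturation_def)
  then have P: "labelled_poset P" by (simp add: eps_consistent_def)
  have g: "g \<in> Bij (lp_elems P)" and eq: "lp_act g P = P"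
    using assms lp_aut_iff[OF P] by auto
  note actQ = saturationD[OF assms(1)] g
  note Q = assms(1)[unfolded saturation_iff[OF cons]]
  note rk = lp_rank_aut[OF cons assms(2)]
  show ?thesis
    unfolding saturation_iff[OF cons]
  proof (intro conjI ballI impI)
    show "labelled_poset (lp_act g Q)" "lp_elems (lp_act g Q) = lp_elems P"
      using labelled_poset_act[OF actQ] lp_elems_act[OF actQ] .
    have "lp_less P = map_prod g g ` lp_less P"
      using lp_less_act[OF P refl g] unfolding eq .
    also have "\<dots> \<subseteq> map_prod g g ` lp_less Q" using Q by (intro image_mono) simp
    finally show "lp_less P \<subseteq> lp_less (lp_act g Q)" unfolding lp_less_act[OF actQ] .
  next
    fix x y assume xy: "x \<in> lp_elems P" "y \<in> lp_elems P" and "\<bar>lp_rank P y - lp_rank P x\<bar> = 1"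
    let ?h = "inv_into (lp_elems P) g"
    have h: "?h x \<in> lp_elems P" "?h y \<in> lp_elems P" "g (?h x) = x" "g (?h y) = y"
      using xy by (simp_all add: Bij_simps[OF g])
    then have "\<bar>lp_rank P (?h y) - lp_rank P (?h x)\<bar> = 1"
      using rk[of "?h x"] rk[of "?h y"] \<open>\<bar>_\<bar> = 1\<close> by simp
    then have "(?h x, ?h y) \<in> lp_le Q \<or> (?h y, ?h x) \<in> lp_le Q" using Q h by blast
    then show "(x, y) \<in> lp_le (lp_act g Q) \<or> (y, x) \<in> lp_le (lp_act g Q)"
      unfolding lp_le_act[OF actQ] using h(3,4) by force
  next
    fix e assume "e \<in> lp_covers (lp_act g Q)"
    then obtain p q where pq: "(p, q) \<in> lp_covers Q" "e = (g p, g q)"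
      using lp_covers_act[OF actQ] by auto
    then have "p \<in> lp_elems P" "q \<in> lp_elems P" and "lp_lab Q (p, q) = lp_rank P q - lp_rank P p"
      using Q lp_covers_subset[OF actQ] by auto
    then show "case e of (p, q) \<Rightarrow> lp_lab (lp_act g Q) (p, q) = lp_rank P q - lp_rank P p"
      using lp_lab_act[OF actQ pq(1)] rk pq(2) by simp
  qed
qed

section \<open>Fixed lattice points\<close>

lemma lattice_points_iff:
  assumes "labelled_poset P"
  shows "f \<in> lattice_points m P \<longleftrightarrow>
    f \<in> lp_elems P \<rightarrow>\<^sub>E {0..real m} \<and> edge_decreasing P f \<and> (\<forall>p\<in>lp_elems P. f p \<in> \<int>)"
  by (auto simp: lattice_points_def order_polytope_iff[OF assms])

lemma finite_lattice_points:
  assumes "labelled_poset P"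
  shows "finite (lattice_points m P)"
proof (rule finite_subset)
  show "lattice_points m P \<subseteq> lp_elems P \<rightarrow>\<^sub>E (real ` {..m})"
  proof
    fix f assume f: "f \<in> lattice_points m P"
    have "f p \<in> real ` {..m}" if "p \<in> lp_elems P" for p
    proof -
      have "f p \<in> \<int>" "0 \<le> f p" "f p \<le> real m"
        using f that by (auto simp: lattice_points_iff[OF assms])
      then have "f p = real (nat \<lfloor>f p\<rfloor>)" "nat \<lfloor>f p\<rfloor> \<le> m" by (auto elim!: Ints_cases)
      then show ?thesis by (metis atMost_iff imageI)
    qed
    then show "f \<in> lp_elems P \<rightarrow>\<^sub>E (real ` {..m})"
      using f by (auto simp: lattice_points_iff[OF assms] PiE_iff)
  qed
  show "finite (lp_elems P \<rightarrow>\<^sub>E real ` {..m})"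
    using labelled_posetD(1)[OF assms] by (intro finite_PiE) auto
qed

text \<open>Stated with f o g instead of f o g^(-1): both describe the points fixed by g, and the
  composite with g is what the trace formula produces.\<close>

definition fixed_points :: "nat \<Rightarrow> 'a lposet \<Rightarrow> ('a \<Rightarrow> 'a) \<Rightarrow> ('a \<Rightarrow> real) set" where
  "fixed_points m P g = {f \<in> lattice_points m P. \<forall>p\<in>lp_elems P. f (g p) = f p}"

lemma finite_fixed_points:
  assumes "labelled_poset P"
  shows "finite (fixed_points m P g)"
  by (rule finite_subset[OF _ finite_lattice_points[OF assms]]) (auto simp: fixed_points_def)

text \<open>The hypotheses say that k is x^(-1) g x on X. As x is an isomorphism from Q onto its
  transport, f -> f o x^(-1) matches the points fixed by k with those fixed by g.\<close>

lemma card_fixed_points_act: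
  assumes Q: "labelled_poset Q" and X: "lp_elems Q = X" and x: "x \<in> Bij X"
    and k: "\<And>p. p \<in> X \<Longrightarrow> k p \<in> X" "\<And>p. p \<in> X \<Longrightarrow> x (k p) = g (x p)"
  shows "card (fixed_points m Q k) = card (fixed_points m (lp_act x Q) g)"
proof -
  let ?h = "inv_into X x"
  note act = Q X x
  note lp = lattice_points_iff[OF Q] lattice_points_iff[OF labelled_poset_act[OF act]]
    edge_decreasing_act[OF act] lp_elems_act[OF act] X
  note h = Bij_simps[OF x]
  \<comment> \<open>Composites are restricted to X and thus \<open>undefined\<close> outside it; the
    edge conditions see values on X only.\<close>
  have cong: "edge_decreasing Q f \<longleftrightarrow> edge_decreasing Q f'" if "\<And>p. p \<in> X \<Longrightarrow> f p = f' p"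
    for f f' :: "_ \<Rightarrow> real"
    using lp_covers_subset[OF act] that unfolding edge_decreasing_def
    by (intro ball_cong) auto
  have "bij_betw (\<lambda>f. \<lambda>p\<in>X. f (?h p)) (fixed_points m Q k) (fixed_points m (lp_act x Q) g)"
  proof (rule bij_betw_byWitness[where f' = "\<lambda>f. \<lambda>p\<in>X. f (x p)"])
    show "\<forall>f\<in>fixed_points m Q k. (\<lambda>p\<in>X. (\<lambda>p\<in>X. f (?h p)) (x p)) = f"
      by (auto simp: fixed_points_def lp h PiE_iff extensional_def fun_eq_iff)
    show "\<forall>f\<in>fixed_points m (lp_act x Q) g. (\<lambda>p\<in>X. (\<lambda>p\<in>X. f (x p)) (?h p)) = f"
      by (auto simp: fixed_points_def lp h PiE_iff extensional_def fun_eq_iff)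
    show "(\<lambda>f. \<lambda>p\<in>X. f (?h p)) ` fixed_points m Q k \<subseteq> fixed_points m (lp_act x Q) g"
    proof clarify
      fix f assume f: "f \<in> fixed_points m Q k"
      have "edge_decreasing Q (\<lambda>p. (\<lambda>p\<in>X. f (?h p)) (x p)) \<longleftrightarrow> edge_decreasing Q f"
        by (rule cong) (simp add: h)
      moreover have "(\<lambda>p\<in>X. f (?h p)) (g p) = (\<lambda>p\<in>X. f (?h p)) p" if "p \<in> X" for p
      proof -
        have "g p = x (k (?h p))" "k (?h p) \<in> X" using that k[of "?h p"] by (simp_all add: h)
        then show ?thesis using that f by (simp add: h fixed_points_def X)
      qed
      ultimately show "(\<lambda>p\<in>X. f (?h p)) \<in> fixed_points m (lp_act x Q) g"
        using f by (auto simp: fixed_points_def lp h PiE_iff)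
    qed
    show "(\<lambda>f. \<lambda>p\<in>X. f (x p)) ` fixed_points m (lp_act x Q) g \<subseteq> fixed_points m Q k"
    proof clarify
      fix f assume f: "f \<in> fixed_points m (lp_act x Q) g"
      have "edge_decreasing Q (\<lambda>p\<in>X. f (x p)) \<longleftrightarrow> edge_decreasing Q (\<lambda>p. f (x p))"
        by (rule cong) simp
      then show "(\<lambda>p\<in>X. f (x p)) \<in> fixed_points m Q k"
        using f by (auto simp: fixed_points_def lp h PiE_iff k)
    qed
  qed
  then show ?thesis by (rule bij_betw_same_card)
qed

lemma fixed_points_decomposition:
  assumes cons: "eps_consistent P" and g: "g \<in> lp_aut P" and fin: "finite (saturations P)"
  shows "card (fixed_points m P g) =
    (\<Sum>Q | Q \<in> saturations P \<and> lp_act g Q = Q. card (fixed_points m Q g))"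
proof -
  have P: "labelled_poset P" using cons by (simp add: eps_consistent_def)
  have gB: "g \<in> Bij (lp_elems P)" using g lp_aut_iff[OF P] by simp
  let ?S = "{Q \<in> saturations P. lp_act g Q = Q}"
  have "fixed_points m P g = (\<Union>Q\<in>?S. fixed_points m Q g)"
  proof (intro equalityI subsetI)
    fix f assume f: "f \<in> fixed_points m P g"
    then have ed: "edge_decreasing P f" by (simp add: fixed_points_def lattice_points_iff[OF P])
    let ?Q = "induced_saturation P f"
    note sat = saturation_induced_saturation[OF cons ed]
    note act = saturationD[OF sat(1)] gB
    have "edge_decreasing ?Q (\<lambda>p. f (g p)) \<longleftrightarrow> edge_decreasing ?Q f"
      using f lp_covers_subset[OF act] unfolding edge_decreasing_def fixed_points_def
      by (intro ball_cong) auto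
    then have "edge_decreasing (lp_act g ?Q) f"
      using sat(2) by (simp add: edge_decreasing_act[OF act])
    then have "lp_act g ?Q = ?Q"
      by (rule saturation_unique(1)[OF saturation_act[OF sat(1) g]])
    moreover have "f \<in> fixed_points m ?Q g"
      using f sat(2) by (simp add: fixed_points_def lattice_points_iff[OF P]
          lattice_points_iff[OF act(1)] act(2))
    ultimately show "f \<in> (\<Union>Q\<in>?S. fixed_points m Q g)"
      using sat(1) by (auto simp: saturations_def)
  next
    fix f assume "f \<in> (\<Union>Q\<in>?S. fixed_points m Q g)"
    then obtain Q where Q: "saturation P Q" "f \<in> fixed_points m Q g" by (auto simp: saturations_def)
    then show "f \<in> fixed_points m P g"
      using saturation_unique(2)[OF Q(1), of f]
      by (simp add: fixed_points_def lattice_points_iff[OF P]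
          lattice_points_iff[OF saturationD(1)[OF Q(1)]] saturationD(2)[OF Q(1)])
  qed
  moreover have "card (\<Union>Q\<in>?S. fixed_points m Q g) = (\<Sum>Q\<in>?S. card (fixed_points m Q g))"
  proof (rule card_UN_disjoint)
    show "finite ?S" using fin by simp
    show "\<forall>Q\<in>?S. finite (fixed_points m Q g)"
      by (auto simp: saturations_def intro: finite_fixed_points saturationD(1))
    have "Q = induced_saturation P f" if "saturation P Q" "f \<in> fixed_points m Q g" for Q f
      by (rule saturation_unique(1)[OF that(1)])
        (use that in \<open>simp add: fixed_points_def lattice_points_iff[OF saturationD(1)[OF that(1)]]\<close>)
    then show "\<forall>Q\<in>?S. \<forall>Q'\<in>?S. Q \<noteq> Q' \<longrightarrow> fixed_points m Q g \<inter> fixed_points m Q' g = {}"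
      unfolding saturations_def by blast
  qed
  ultimately show ?thesis by simp
qed

section \<open>Traces of permutation representations and exterior powers\<close>

lemma sum_fun_apply: "(\<Sum>i\<in>A. f i) x = (\<Sum>i\<in>A. f i x)"
  for f :: "'i \<Rightarrow> 'x \<Rightarrow> 'b::comm_monoid_add"
  by (induction A rule: infinite_finite_induct) auto

definition linear_endo ::
    "('x \<Rightarrow> complex) set \<Rightarrow> (('x \<Rightarrow> complex) \<Rightarrow> 'x \<Rightarrow> complex) \<Rightarrow> bool" where
  "linear_endo V T \<longleftrightarrow> (\<forall>v\<in>V. T v \<in> V) \<and> (\<forall>v\<in>V. \<forall>w\<in>V. T (v + w) = T v + T w) \<and>
     (\<forall>c. \<forall>v\<in>V. T (scale_fun c v) = scale_fun c (T v))"

lemma linear_endo_sum: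
  assumes "linear_endo V T" "cfun.subspace V" "\<And>i. i \<in> I \<Longrightarrow> v i \<in> V"
  shows "T (\<Sum>i\<in>I. scale_fun (c i) (v i)) = (\<Sum>i\<in>I. scale_fun (c i) (T (v i)))"
proof -
  have zero: "T 0 = 0"
  proof -
    have "T (scale_fun 0 0) = scale_fun 0 (T 0)"
      using assms(1) cfun.subspace_0[OF assms(2)] unfolding linear_endo_def by blast
    then show ?thesis by simp
  qed
  show ?thesis
    using assms(3)
  proof (induction I rule: infinite_finite_induct)
    case (insert i I)
    have mem: "v i \<in> V" "scale_fun (c i) (v i) \<in> V" "(\<Sum>i\<in>I. scale_fun (c i) (v i)) \<in> V"
      using insert.prems by (auto intro!: cfun.subspace_scale[OF assms(2)] cfun.subspace_sum[OF assms(2)])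
    have "T (\<Sum>i\<in>insert i I. scale_fun (c i) (v i)) =
        T (scale_fun (c i) (v i) + (\<Sum>i\<in>I. scale_fun (c i) (v i)))"
      by (simp only: sum.insert[OF insert.hyps])
    also have "\<dots> = T (scale_fun (c i) (v i)) + T (\<Sum>i\<in>I. scale_fun (c i) (v i))"
      using mem assms(1) unfolding linear_endo_def by blast
    also have "T (scale_fun (c i) (v i)) = scale_fun (c i) (T (v i))"
      using mem assms(1) unfolding linear_endo_def by blast
    also have "T (\<Sum>i\<in>I. scale_fun (c i) (v i)) = (\<Sum>i\<in>I. scale_fun (c i) (T (v i)))"
      using insert by blast
    finally show ?case by (simp only: sum.insert[OF insert.hyps])
  qed (simp_all add: zero)
qed

text \<open>Both sides expand to the same double sum over matrix entries of S and T between the two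
  bases. With S the identity this is independence of the basis, with B = C it is invariance under
  swapping the factors.\<close>

lemma trace_commute_bases:
  assumes V: "cfun.subspace V"
    and B: "finite B" "cfun.independent B" "cfun.span B = V"
    and C: "finite C" "cfun.independent C" "cfun.span C = V"
    and S: "linear_endo V S" and T: "linear_endo V T"
  shows "(\<Sum>b\<in>B. cfun.representation B (S (T b)) b) = (\<Sum>c\<in>C. cfun.representation C (T (S c)) c)"
proof -
  \<comment> \<open>Quantified afresh over bases and maps because it is used twice, the second time
    with the roles of B, C and of S, T exchanged.\<close>
  have coeff: "cfun.representation B (S (T b)) b =
      (\<Sum>c\<in>C. cfun.representation C (T b) c * cfun.representation B (S c) b)"
    if B: "cfun.independent B" "cfun.span B = V" "b \<in> B"
      and C: "finite C" "cfun.independent C" "cfun.span C = V"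
      and S: "linear_endo V S" and T: "linear_endo V T"
    for B C b and S T :: "('a \<Rightarrow> complex) \<Rightarrow> 'a \<Rightarrow> complex"
  proof -
    have bV: "b \<in> V" using B cfun.span_base by metis
    have CV: "c \<in> V" if "c \<in> C" for c using C that cfun.span_base by metis
    have ScV: "S c \<in> cfun.span B" if "c \<in> C" for c
      using CV[OF that] S B by (auto simp: linear_endo_def)
    have "T b = (\<Sum>c\<in>C. scale_fun (cfun.representation C (T b) c) c)"
      using cfun.sum_representation_eq[OF C(2) _ C(1) subset_refl, of "T b"] T bV C
      by (simp add: linear_endo_def)
    then have "S (T b) = (\<Sum>c\<in>C. scale_fun (cfun.representation C (T b) c) (S c))"
      using linear_endo_sum[OF S V, of C "\<lambda>c. c"] CV by metis
    then have "cfun.representation B (S (T b)) =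
        cfun.representation B (\<Sum>c\<in>C. scale_fun (cfun.representation C (T b) c) (S c))" by simp
    also have "\<dots> = (\<lambda>d. \<Sum>c\<in>C. cfun.representation B (scale_fun (cfun.representation C (T b) c) (S c)) d)"
      by (rule cfun.representation_sum[OF B(1)]) (auto intro: cfun.span_scale ScV)
    finally have "cfun.representation B (S (T b)) b =
        (\<Sum>c\<in>C. cfun.representation B (scale_fun (cfun.representation C (T b) c) (S c)) b)" by simp
    also have "\<dots> = (\<Sum>c\<in>C. cfun.representation C (T b) c * cfun.representation B (S c) b)"
      by (intro sum.cong) (auto simp: cfun.representation_scale[OF B(1) ScV])
    finally show ?thesis .
  qed
  have "(\<Sum>b\<in>B. cfun.representation B (S (T b)) b) =
      (\<Sum>b\<in>B. \<Sum>c\<in>C. cfun.representation C (T b) c * cfun.representation B (S c) b)"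
    by (intro sum.cong refl coeff assms)
  also have "\<dots> = (\<Sum>c\<in>C. \<Sum>b\<in>B. cfun.representation B (S c) b * cfun.representation C (T b) c)"
    by (subst sum.swap) (simp add: mult.commute)
  also have "\<dots> = (\<Sum>c\<in>C. cfun.representation C (T (S c)) c)"
    by (intro sum.cong refl coeff[symmetric] assms)
  finally show ?thesis .
qed

text \<open>The basis inside \<open>trace_on\<close> comes from a choice operator; it exists because
  V is a subspace, and it is finite because it is independent in the span of the finite set
  F.\<close>

lemma trace_on_some_basis:
  assumes "cfun.subspace V" "V \<subseteq> cfun.span F" "finite F"
  obtains B where "finite B" "cfun.independent B" "cfun.span B = V"
    "\<And>T. trace_on V T = (\<Sum>b\<in>B. cfun.representation B (T b) b)"
proof -
  obtain C where "C \<subseteq> V" "cfun.independent C" "V \<subseteq> cfun.span C"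
    using cfun.basis_exists[of V] by metis
  then have "cfun.independent C \<and> cfun.span C = V"
    using cfun.span_minimal[OF _ assms(1)] by blast
  then have B: "cfun.independent (SOME B. cfun.independent B \<and> cfun.span B = V)"
      "cfun.span (SOME B. cfun.independent B \<and> cfun.span B = V) = V" (is "cfun.span ?B = V")
    using someI[of "\<lambda>B. cfun.independent B \<and> cfun.span B = V"] by blast+
  have "?B \<subseteq> cfun.span F" using B(2) assms(2) cfun.span_superset by blast
  then have "finite ?B" using cfun.independent_span_bound[OF assms(3) B(1)] by blast
  from that[OF this B] show thesis by (simp add: trace_on_def Let_def)
qed

lemma trace_on_eq_sum:
  assumes "cfun.subspace V" "finite B" "cfun.independent B" "cfun.span B = V" "linear_endo V T"
  shows "trace_on V T = (\<Sum>b\<in>B. cfun.representation B (T b) b)"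
proof -
  obtain C where C: "finite C" "cfun.independent C" "cfun.span C = V"
    "\<And>T. trace_on V T = (\<Sum>b\<in>C. cfun.representation C (T b) b)"
    using trace_on_some_basis[OF assms(1) _ assms(2)] assms(4) by blast
  have "linear_endo V (\<lambda>v. v)" by (simp add: linear_endo_def)
  from trace_commute_bases[OF assms(1) C(1-3) assms(2-4) this assms(5)] show ?thesis
    by (simp add: C(4))
qed

lemma trace_on_commute:
  assumes "cfun.subspace V" "V \<subseteq> cfun.span F" "finite F" "linear_endo V S" "linear_endo V T"
  shows "trace_on V (\<lambda>v. S (T v)) = trace_on V (\<lambda>v. T (S v))"
proof -
  obtain C where C: "finite C" "cfun.independent C" "cfun.span C = V"
    "\<And>T. trace_on V T = (\<Sum>b\<in>C. cfun.representation C (T b) b)"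
    using trace_on_some_basis[OF assms(1-3)] by blast
  show ?thesis
    unfolding C(4) by (rule trace_commute_bases[OF assms(1) C(1-3) C(1-3) assms(4,5)])
qed

section \<open>Coordinate spaces, standard bases and permutation traces\<close>

lemma subspace_coord_space: "cfun.subspace (coord_space L)"
  by (rule cfun.subspaceI) (auto simp: coord_space_def scale_fun_def)

lemma inj_std_basis: "inj std_basis"
  by (rule injI) (metis std_basis_def zero_neq_one)

lemma sum_std_basis_apply:
  assumes "finite L"
  shows "(\<Sum>b\<in>std_basis ` L. scale_fun (u b) b) y = (if y \<in> L then u (std_basis y) else 0)"
proof -
  have "(\<Sum>b\<in>std_basis ` L. scale_fun (u b) b) y = (\<Sum>x\<in>L. u (std_basis x) * std_basis x y)"
    by (subst sum.reindex[OF inj_on_subset[OF inj_std_basis subset_UNIV]])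
      (simp add: sum_fun_apply scale_fun_def)
  also have "\<dots> = (if y \<in> L then u (std_basis y) else 0)"
    using assms by (simp add: std_basis_def sum.delta' if_distrib cong: if_cong)
  finally show ?thesis .
qed

lemma independent_std_basis:
  assumes "finite L"
  shows "cfun.independent (std_basis ` L)"
proof
  assume "cfun.dependent (std_basis ` L)"
  then obtain u y where y: "y \<in> L" "u (std_basis y) \<noteq> 0"
    and "(\<Sum>b\<in>std_basis ` L. scale_fun (u b) b) = 0"
    using assms by (auto simp: cfun.dependent_finite)
  then show False
    using sum_std_basis_apply[OF assms, of u y] by simp
qed

lemma span_std_basis:
  assumes "finite L"
  shows "cfun.span (std_basis ` L) = coord_space L"
proof
  show "cfun.span (std_basis ` L) \<subseteq> coord_space L"
    by (rule cfun.span_minimal[OF _ subspace_coord_space]) (auto simp: coord_space_def std_basis_def)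
  show "coord_space L \<subseteq> cfun.span (std_basis ` L)"
  proof
    fix v assume v: "v \<in> coord_space L"
    have "(\<Sum>b\<in>std_basis ` L. scale_fun (v (the_inv std_basis b)) b) = v"
      using v by (auto simp: sum_std_basis_apply[OF assms] the_inv_f_f[OF inj_std_basis] coord_space_def)
    moreover have "(\<Sum>b\<in>std_basis ` L. scale_fun (v (the_inv std_basis b)) b) \<in> cfun.span (std_basis ` L)"
      by (intro cfun.span_sum cfun.span_scale cfun.span_base)
    ultimately show "v \<in> cfun.span (std_basis ` L)" by simp
  qed
qed

lemma representation_std_basis:
  assumes "finite L" "v \<in> coord_space L" "y \<in> L"
  shows "cfun.representation (std_basis ` L) v (std_basis y) = v y"
proof -
  have "(\<Sum>b\<in>std_basis ` L. scale_fun (cfun.representation (std_basis ` L) v b) b) = v"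
    using assms by (intro cfun.sum_representation_eq independent_std_basis)
      (auto simp: span_std_basis)
  from fun_cong[OF this, of y] show ?thesis
    using assms by (simp add: sum_std_basis_apply)
qed

text \<open>In the standard basis the diagonal entry at f is 1 or 0 according to whether f is fixed.
  The inverse of g appears because \<open>perm_rep\<close> acts by precomposition.\<close>

lemma trace_perm_rep:
  assumes "finite L"
  shows "trace_on (coord_space L) (perm_rep G L \<phi> g) = of_nat (card {f \<in> L. \<phi> (inv\<^bsub>G\<^esub> g) f = f})"
proof -
  have "linear_endo (coord_space L) (perm_rep G L \<phi> g)"
    by (auto simp: linear_endo_def perm_rep_def coord_space_def scale_fun_def)
  then have "trace_on (coord_space L) (perm_rep G L \<phi> g) =
      (\<Sum>b\<in>std_basis ` L. cfun.representation (std_basis ` L) (perm_rep G L \<phi> g b) b)"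
    using assms by (intro trace_on_eq_sum subspace_coord_space independent_std_basis)
      (auto simp: span_std_basis)
  also have "\<dots> = (\<Sum>f\<in>L. cfun.representation (std_basis ` L) (perm_rep G L \<phi> g (std_basis f)) (std_basis f))"
    by (rule sum.reindex_cong[OF inj_on_subset[OF inj_std_basis subset_UNIV]]) auto
  also have "\<dots> = (\<Sum>f\<in>L. perm_rep G L \<phi> g (std_basis f) f)"
    by (intro sum.cong refl representation_std_basis assms) (auto simp: perm_rep_def coord_space_def)
  also have "\<dots> = (\<Sum>f\<in>L. if \<phi> (inv\<^bsub>G\<^esub> g) f = f then 1 else 0)"
    by (intro sum.cong) (auto simp: perm_rep_def std_basis_def)
  also have "\<dots> = of_nat (card {f \<in> L. \<phi> (inv\<^bsub>G\<^esub> g) f = f})"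
    using assms by (simp add: sum.If_cases Int_def)
  finally show ?thesis .
qed

section \<open>Exterior powers of permutation representations\<close>

definition tuple_pullback :: "'x set \<Rightarrow> nat \<Rightarrow> ('x \<Rightarrow> 'x) \<Rightarrow> ('x list \<Rightarrow> complex) \<Rightarrow> 'x list \<Rightarrow> complex" where
  "tuple_pullback X i k w = (\<lambda>xs. if xs \<in> tuples X i then w (map k xs) else 0)"

definition ext_trace :: "'x set \<Rightarrow> nat \<Rightarrow> ('x \<Rightarrow> 'x) \<Rightarrow> complex" where
  "ext_trace X i k = trace_on (ext_power X i) (tuple_pullback X i k)"

lemma finite_tuples: "finite X \<Longrightarrow> finite (tuples X i)"
  unfolding tuples_def by (rule finite_lists_length_eq)

lemma map_tuples: "k \<in> X \<rightarrow> X \<Longrightarrow> xs \<in> tuples X i \<Longrightarrow> map k xs \<in> tuples X i"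
  by (auto simp: tuples_def)

text \<open>A product of entries of a permutation matrix is nonzero for just one column tuple,
  \<open>map k xs\<close> with k the inverse of g, so the sum over tuples collapses to one
  term.\<close>

lemma ext_power_map_perm_rep:
  assumes "finite X" "inv\<^bsub>G\<^esub> g \<in> X \<rightarrow> X"
  shows "ext_power_map X i (perm_rep G X (\<lambda>g. g) g) = tuple_pullback X i (inv\<^bsub>G\<^esub> g)"
proof (intro ext)
  fix w :: "'a list \<Rightarrow> complex" and xs
  let ?k = "inv\<^bsub>G\<^esub> g"
  show "ext_power_map X i (perm_rep G X (\<lambda>g. g) g) w xs = tuple_pullback X i ?k w xs"
  proof (cases "xs \<in> tuples X i")
    case True
    then have xs: "length xs = i" "set xs \<subseteq> X" by (auto simp: tuples_def)
    have prod: "(\<Prod>j<i. perm_rep G X (\<lambda>g. g) g (std_basis (ys ! j)) (xs ! j)) =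
        (if map ?k xs = ys then 1 else 0)" if "ys \<in> tuples X i" for ys
    proof -
      have "(\<Prod>j<i. perm_rep G X (\<lambda>g. g) g (std_basis (ys ! j)) (xs ! j)) =
          (\<Prod>j<i. if ?k (xs ! j) = ys ! j then 1 else 0)"
        using nth_mem[of _ xs] xs by (intro prod.cong) (auto simp: perm_rep_def std_basis_def simp del: nth_mem)
      also have "\<dots> = (if \<forall>j<i. ?k (xs ! j) = ys ! j then 1 else 0)"
        by (auto intro: prod.neutral)
      also have "(\<forall>j<i. ?k (xs ! j) = ys ! j) \<longleftrightarrow> map ?k xs = ys"
        using that xs by (auto simp: list_eq_iff_nth_eq tuples_def)
      finally show ?thesis .
    qed
    have "(\<Sum>ys\<in>tuples X i. (\<Prod>j<i. perm_rep G X (\<lambda>g. g) g (std_basis (ys ! j)) (xs ! j)) * w ys) =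
        (\<Sum>ys\<in>tuples X i. if map ?k xs = ys then w ys else 0)"
      by (intro sum.cong) (auto simp: prod)
    also have "\<dots> = w (map ?k xs)"
      using map_tuples[OF assms(2) True] finite_tuples[OF assms(1)] by simp
    finally show ?thesis
      using True by (simp add: ext_power_map_def tuple_pullback_def)
  qed (simp add: ext_power_map_def tuple_pullback_def)
qed

lemma subspace_ext_power: "cfun.subspace (ext_power X i)"
  by (rule cfun.subspaceI)
    (auto simp: ext_power_def scale_fun_def coord_space_def algebra_simps)

lemma ext_power_subset_span: "finite X \<Longrightarrow> ext_power X i \<subseteq> cfun.span (std_basis ` tuples X i)"
  by (auto simp: span_std_basis finite_tuples ext_power_def)

text \<open>Applying k to the entries commutes with permuting the positions, so alternating tensors
  stay alternating.\<close>

lemma linear_endo_tuple_pullback: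
  assumes "k \<in> X \<rightarrow> X"
  shows "linear_endo (ext_power X i) (tuple_pullback X i k)"
proof -
  have "tuple_pullback X i k w \<in> ext_power X i" if w: "w \<in> ext_power X i" for w
    unfolding ext_power_def
  proof (intro CollectI conjI ballI allI impI)
    show "tuple_pullback X i k w \<in> coord_space (tuples X i)"
      by (simp add: coord_space_def tuple_pullback_def)
    fix xs \<sigma> assume xs: "xs \<in> tuples X i" and \<sigma>: "\<sigma> permutes {..<i}"
    then have len: "\<sigma> permutes {..<length xs}" by (simp add: tuples_def)
    have "permute_list \<sigma> xs \<in> tuples X i"
      using xs len by (simp add: tuples_def)
    moreover have "w (permute_list \<sigma> (map k xs)) = of_int (sign \<sigma>) * w (map k xs)"
      using w map_tuples[OF assms xs] \<sigma> by (simp add: ext_power_def)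
    ultimately show "tuple_pullback X i k w (permute_list \<sigma> xs) = of_int (sign \<sigma>) * tuple_pullback X i k w xs"
      using xs by (simp add: tuple_pullback_def permute_list_map[OF len])
  qed
  then show ?thesis
    by (auto simp: linear_endo_def tuple_pullback_def scale_fun_def)
qed

lemma ext_trace_cong:
  assumes "\<And>p. p \<in> X \<Longrightarrow> k p = l p"
  shows "ext_trace X i k = ext_trace X i l"
proof -
  have "map k xs = map l xs" if "xs \<in> tuples X i" for xs
    using that assms by (auto simp: tuples_def)
  then have "tuple_pullback X i k = tuple_pullback X i l"
    by (intro ext) (simp add: tuple_pullback_def del: map_eq_conv)
  then show ?thesis by (simp add: ext_trace_def)
qed

text \<open>Pulling back reverses composition, so the two sides are the traces of the two products
  of the same pair of endomorphisms.\<close>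

lemma ext_trace_commute:
  assumes "finite X" "k \<in> X \<rightarrow> X" "l \<in> X \<rightarrow> X"
  shows "ext_trace X i (\<lambda>p. k (l p)) = ext_trace X i (\<lambda>p. l (k p))"
proof -
  have "tuple_pullback X i (\<lambda>p. k (l p)) w = tuple_pullback X i l (tuple_pullback X i k w)"
    if "l \<in> X \<rightarrow> X" for k l w
    using map_tuples[OF that] by (auto simp: tuple_pullback_def comp_def)
  then have "ext_trace X i (\<lambda>p. k (l p)) =
        trace_on (ext_power X i) (\<lambda>w. tuple_pullback X i l (tuple_pullback X i k w))"
      "ext_trace X i (\<lambda>p. l (k p)) =
        trace_on (ext_power X i) (\<lambda>w. tuple_pullback X i k (tuple_pullback X i l w))"
    using assms unfolding ext_trace_def
    by (auto intro!: arg_cong[where f = "trace_on _"])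
  then show ?thesis
    using trace_on_commute[OF subspace_ext_power ext_power_subset_span[OF assms(1)]
        finite_imageI[OF finite_tuples[OF assms(1)]]
        linear_endo_tuple_pullback[OF assms(3)] linear_endo_tuple_pullback[OF assms(2)]]
    by simp
qed

section \<open>Coefficients of the equivariant series\<close>

lemma inv_restricted_BijGroup:
  assumes "subgroup H (BijGroup X)" "g \<in> H"
  shows "inv\<^bsub>(BijGroup X)\<lparr>carrier := H\<rparr>\<^esub> g = (\<lambda>x\<in>X. inv_into X g x)" "g \<in> Bij X"
proof -
  show "g \<in> Bij X"
    using assms subgroup.subset by (fastforce simp: BijGroup_simps)
  then show "inv\<^bsub>(BijGroup X)\<lparr>carrier := H\<rparr>\<^esub> g = (\<lambda>x\<in>X. inv_into X g x)"
    using group.m_inv_consistent[OF group_BijGroup assms] by (simp add: inv_BijGroup)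
qed

lemma finite_subgroup_BijGroup:
  assumes "subgroup H (BijGroup X)" "finite X"
  shows "finite H"
proof (rule finite_subset)
  show "H \<subseteq> X \<rightarrow>\<^sub>E X"
    using subgroup.subset[OF assms(1)] by (auto simp: BijGroup_simps Bij_def PiE_def bij_betw_def)
  show "finite (X \<rightarrow>\<^sub>E X)" using assms(2) by (intro finite_PiE)
qed

lemma lattice_char_eq:
  assumes P: "labelled_poset P" and X: "lp_elems P = X" and H: "subgroup H (BijGroup X)"
    and G: "G = (BijGroup X)\<lparr>carrier := H\<rparr>"
  shows "lattice_char G P m g = (if g \<in> H then of_nat (card (fixed_points m P g)) else 0)"
proof (cases "g \<in> H")
  case True
  note inv = inv_restricted_BijGroup[OF H True]
  note B = Bij_simps[OF inv(2)]
  define k where "k = (\<lambda>x\<in>X. inv_into X g x)"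
  have k: "k \<in> Bij X" unfolding k_def by (rule restrict_inv_into_Bij[OF inv(2)])
  \<comment> \<open>\<open>perm_rep\<close> applies the action of the inverse of g and
    \<open>fun_act\<close> inverts once more; the two inversions cancel.\<close>
  have "inv_into X k p = g p" if "p \<in> X" for p
    using that Bij_simps(3)[OF k, of "g p"] B by (simp add: k_def)
  then have "fun_act X k f = f \<longleftrightarrow> (\<forall>p\<in>X. f (g p) = f p)" if "f \<in> lattice_points m P" for f
    using that unfolding lattice_points_iff[OF P] X
    by (auto simp: fun_act_def fun_eq_iff PiE_iff extensional_def)
  then have "{f \<in> lattice_points m P. fun_act X k f = f} = fixed_points m P g"
    by (auto simp: fixed_points_def X)
  then show ?thesis
    using True inv(1) unfolding lattice_char_def rep_character_def
    by (simp add: trace_perm_rep[OF finite_lattice_points[OF P]] G X k_def)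
qed (simp add: lattice_char_def rep_character_def G)

lemma ext_power_char_eq:
  assumes P: "labelled_poset P" and X: "lp_elems P = X" and H: "subgroup H (BijGroup X)"
    and G: "G = (BijGroup X)\<lparr>carrier := H\<rparr>"
  shows "ext_power_char G P i g = (if g \<in> H then ext_trace X i (inv_into X g) else 0)"
proof (cases "g \<in> H")
  case True
  note inv = inv_restricted_BijGroup[OF H True, folded G]
  have fin: "finite X" using labelled_posetD(1)[OF P] X by simp
  have "inv\<^bsub>G\<^esub> g \<in> X \<rightarrow> X" by (auto simp: inv(1) Bij_simps[OF inv(2)])
  then have "ext_power_char G P i g = ext_trace X i (inv\<^bsub>G\<^esub> g)"
    using True ext_power_map_perm_rep[OF fin, of G g i]
    by (simp add: ext_power_char_def rep_character_def ext_trace_def X) (simp add: G)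
  also have "\<dots> = ext_trace X i (inv_into X g)"
    by (rule ext_trace_cong) (simp add: inv(1))
  finally show ?thesis using True by simp
qed (simp add: ext_power_char_def rep_character_def G)

text \<open>The coefficient of t^k in det(1 - t g) on \<complex>^X, expressed through traces on
  exterior powers. It sees only the ground set and g, hence agrees for P and all its
  saturations.\<close>

definition ext_coeff :: "'a set \<Rightarrow> ('a \<Rightarrow> 'a) \<Rightarrow> nat \<Rightarrow> complex" where
  "ext_coeff X g k = (if k \<le> card X then (-1) ^ k * ext_trace X k (inv_into X g) else 0)"

text \<open>The factor 1 - t is absorbed into a difference of consecutive coefficients; the case
  distinction guards against truncated subtraction at n - j = 0. No group occurs in it.\<close>

definition h_star_coeff :: "'a lposet \<Rightarrow> nat \<Rightarrow> ('a \<Rightarrow> 'a) \<Rightarrow> complex" where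
  "h_star_coeff P n g =
     (\<Sum>j=0..n. of_nat (card (fixed_points j P g)) *
        (ext_coeff (lp_elems P) g (n - j) -
         (if n - j = 0 then 0 else ext_coeff (lp_elems P) g (n - j - 1))))"

lemma neg_one_power_fun_apply: "((-1) ^ i :: 'x \<Rightarrow> complex) g = (-1) ^ i"
  by (induction i) auto

text \<open>The group enters through the support alone. So the series of Q over Aut(Q), restricted
  to a stabilizer, can be compared with the series of P over G value by value.\<close>

lemma h_star_nth:
  assumes P: "labelled_poset P" and X: "lp_elems P = X" and H: "subgroup H (BijGroup X)"
    and G: "G = (BijGroup X)\<lparr>carrier := H\<rparr>"
  shows "fps_nth (h_star G P) n g = (if g \<in> H then h_star_coeff P n g else 0)"
proof -
  define S where "S = (\<Sum>i\<le>card X. fps_const ((-1) ^ i * ext_power_char G P i) * fps_X ^ i)"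
  have S: "fps_nth S k = (if k \<le> card X then (-1) ^ k * ext_power_char G P k else 0)" for k
    unfolding S_def by (simp add: fps_sum_nth if_distrib cong: if_cong)
  have S_apply: "fps_nth S k g = ext_coeff X g k" if "g \<in> H" for k
    using that by (simp add: S ext_coeff_def ext_power_char_eq[OF assms] neg_one_power_fun_apply)
  have "h_star G P = Abs_fps (lattice_char G P) * ((1 - fps_X) * S)"
    by (simp add: h_star_def S_def X mult.assoc)
  then have "fps_nth (h_star G P) n =
      (\<Sum>j=0..n. lattice_char G P j * (fps_nth S (n - j) - (if n - j = 0 then 0 else fps_nth S (n - j - 1))))"
    by (simp add: fps_mult_nth[of "Abs_fps (lattice_char G P)"] left_diff_distrib fps_X_mult_nth)
  then have "fps_nth (h_star G P) n g =
      (\<Sum>j=0..n. lattice_char G P j g *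
        (fps_nth S (n - j) g - (if n - j = 0 then 0 else fps_nth S (n - j - 1) g)))"
    by (simp add: sum_fun_apply if_distrib[of "\<lambda>f. f g"] cong: if_cong)
  also have "\<dots> = (if g \<in> H then h_star_coeff P n g else 0)"
    using S_apply unfolding h_star_coeff_def X
    by (simp add: lattice_char_eq[OF assms] cong: if_cong)
  finally show ?thesis .
qed

text \<open>On X the inverse of k is x^(-1) composed with g^(-1) x. Moving x^(-1) to the other end
  inside the trace cancels it against x.\<close>

lemma ext_coeff_conj:
  assumes fin: "finite X" and x: "x \<in> Bij X" and g: "g \<in> Bij X" and k: "k \<in> Bij X"
    and conj: "\<And>p. p \<in> X \<Longrightarrow> x (k p) = g (x p)"
  shows "ext_coeff X k i = ext_coeff X g i"
proof -
  note bx = Bij_simps[OF x] and bg = Bij_simps[OF g] and bk = Bij_simps[OF k]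
  have fs: "inv_into X x \<in> X \<rightarrow> X" "(\<lambda>p. inv_into X g (x p)) \<in> X \<rightarrow> X"
    by (auto simp: bx bg)
  have "inv_into X k p = inv_into X x (inv_into X g (x p))" if "p \<in> X" for p
  proof -
    have "x p = g (x (inv_into X k p))" using conj[of "inv_into X k p"] that by (simp add: bk)
    then show ?thesis using that by (simp add: bx bg bk)
  qed
  then have "ext_trace X i (inv_into X k) = ext_trace X i (\<lambda>p. inv_into X x (inv_into X g (x p)))"
    by (rule ext_trace_cong)
  also have "\<dots> = ext_trace X i (\<lambda>p. inv_into X g (x (inv_into X x p)))"
    by (rule ext_trace_commute[OF fin fs])
  also have "\<dots> = ext_trace X i (inv_into X g)"
    by (rule ext_trace_cong) (simp add: bx)
  finally show ?thesis by (simp add: ext_coeff_def)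
qed

lemma h_star_coeff_conj:
  assumes Q: "labelled_poset Q" and X: "lp_elems Q = X"
    and x: "x \<in> Bij X" and g: "g \<in> Bij X" and k: "k \<in> Bij X"
    and conj: "\<And>p. p \<in> X \<Longrightarrow> x (k p) = g (x p)"
  shows "h_star_coeff Q n k = h_star_coeff (lp_act x Q) n g"
proof -
  have "finite X" using labelled_posetD(1)[OF Q] X by simp
  then show ?thesis
    using card_fixed_points_act[OF Q X x, of k g, OF Bij_simps(1)[OF k] conj] ext_coeff_conj[OF _ x g k conj]
    by (simp add: h_star_coeff_def X lp_elems_act[OF Q X x] cong: if_cong)
qed

text \<open>The coefficient is linear in the fixed-point counts, and its other factors are common to
  P and its saturations.\<close>

lemma h_star_coeff_decomposition:
  assumes cons: "eps_consistent P" and g: "g \<in> lp_aut P" and fin: "finite (saturations P)"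
  shows "h_star_coeff P n g = (\<Sum>Q\<in>saturations P. if lp_act g Q = Q then h_star_coeff Q n g else 0)"
proof -
  let ?c = "\<lambda>k. ext_coeff (lp_elems P) g k - (if k = 0 then 0 else ext_coeff (lp_elems P) g (k - 1))"
  let ?S = "{Q. Q \<in> saturations P \<and> lp_act g Q = Q}"
  have "h_star_coeff P n g = (\<Sum>j=0..n. \<Sum>Q\<in>?S. of_nat (card (fixed_points j Q g)) * ?c (n - j))"
    by (simp add: h_star_coeff_def fixed_points_decomposition[OF assms] sum_distrib_right)
  also have "\<dots> = (\<Sum>Q\<in>?S. \<Sum>j=0..n. of_nat (card (fixed_points j Q g)) * ?c (n - j))"
    by (rule sum.swap)
  also have "\<dots> = (\<Sum>Q\<in>?S. h_star_coeff Q n g)"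
  proof (rule sum.cong)
    fix Q assume "Q \<in> ?S"
    then have "lp_elems Q = lp_elems P" using saturationD(2) by (auto simp: saturations_def)
    then show "(\<Sum>j=0..n. of_nat (card (fixed_points j Q g)) * ?c (n - j)) = h_star_coeff Q n g"
      by (simp only: h_star_coeff_def)
  qed simp
  also have "\<dots> = (\<Sum>Q\<in>saturations P. if lp_act g Q = Q then h_star_coeff Q n g else 0)"
    using fin by (simp add: sum.inter_filter)
  finally show ?thesis .
qed

section \<open>Induction from stabilizers\<close>

lemma orbit_lp_act:
  assumes Q: "labelled_poset Q" and X: "lp_elems Q = X" and H: "subgroup H (BijGroup X)"
    and x: "x \<in> H"
  shows "(\<lambda>y. lp_act y (lp_act x Q)) ` H = (\<lambda>y. lp_act y Q) ` H"
proof -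
  interpret group "BijGroup X" by (rule group_BijGroup)
  interpret H: subgroup H "BijGroup X" by fact
  have mult: "lp_act y (lp_act x Q) = lp_act (y \<otimes>\<^bsub>BijGroup X\<^esub> x) Q" if "y \<in> H" for y
    using that x H.mem_carrier by (intro lp_act_mult[OF Q X, symmetric]) (auto simp: BijGroup_simps(1)[symmetric])
  have "z \<in> (\<lambda>y. y \<otimes>\<^bsub>BijGroup X\<^esub> x) ` H" if "z \<in> H" for z
    using that x H.mem_carrier
    by (intro image_eqI[of _ _ "z \<otimes>\<^bsub>BijGroup X\<^esub> inv\<^bsub>BijGroup X\<^esub> x"]) (simp_all add: m_assoc)
  then have "(\<lambda>y. y \<otimes>\<^bsub>BijGroup X\<^esub> x) ` H = H"
    using x by auto
  then have "(\<lambda>y. lp_act y Q) ` H = (\<lambda>y. lp_act y Q) ` (\<lambda>y. y \<otimes>\<^bsub>BijGroup X\<^esub> x) ` H"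
    by simp
  also have "\<dots> = (\<lambda>y. lp_act y (lp_act x Q)) ` H"
    by (simp add: image_image mult)
  finally show ?thesis by simp
qed

text \<open>The orbit-stabilizer theorem in summed form: the fiber of x -> xQ over yQ is the coset y
  K of the stabilizer K, so every orbit element is hit \<open>card K\<close> times.\<close>

lemma sum_orbit:
  fixes \<phi> :: "'a lposet \<Rightarrow> complex"
  assumes Q: "labelled_poset Q" and X: "lp_elems Q = X" and H: "subgroup H (BijGroup X)"
    and fin: "finite H"
  shows "(\<Sum>x\<in>H. \<phi> (lp_act x Q)) =
    of_nat (card {g \<in> H. lp_act g Q = Q}) * (\<Sum>R\<in>(\<lambda>x. lp_act x Q) ` H. \<phi> R)"
proof -
  interpret group "BijGroup X" by (rule group_BijGroup)
  interpret H: subgroup H "BijGroup X" by fact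
  let ?K = "{g \<in> H. lp_act g Q = Q}"
  have Bij: "g \<in> Bij X" if "g \<in> H" for g using H.subset that by (auto simp: BijGroup_simps)
  have mult: "lp_act (x \<otimes>\<^bsub>BijGroup X\<^esub> y) Q = lp_act x (lp_act y Q)" if "x \<in> H" "y \<in> H" for x y
    using that by (intro lp_act_mult[OF Q X] Bij)
  have fiber: "card {x \<in> H. lp_act x Q = R} = card ?K" if R: "R \<in> (\<lambda>x. lp_act x Q) ` H" for R
  proof -
    obtain y where y: "y \<in> H" "R = lp_act y Q" using R by auto
    have "bij_betw (\<lambda>g. y \<otimes>\<^bsub>BijGroup X\<^esub> g) ?K {x \<in> H. lp_act x Q = R}"
    proof (rule bij_betw_byWitness[where f' = "\<lambda>g. inv\<^bsub>BijGroup X\<^esub> y \<otimes>\<^bsub>BijGroup X\<^esub> g"])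
      show "(\<lambda>g. inv\<^bsub>BijGroup X\<^esub> y \<otimes>\<^bsub>BijGroup X\<^esub> g) ` {x \<in> H. lp_act x Q = R} \<subseteq> ?K"
      proof clarify
        fix x assume x: "x \<in> H" and R: "R = lp_act x Q"
        have "lp_act (inv\<^bsub>BijGroup X\<^esub> y \<otimes>\<^bsub>BijGroup X\<^esub> x) Q = lp_act (inv\<^bsub>BijGroup X\<^esub> y) (lp_act y Q)"
          using mult[of "inv\<^bsub>BijGroup X\<^esub> y" x] x y R by simp
        also have "\<dots> = lp_act (inv\<^bsub>BijGroup X\<^esub> y \<otimes>\<^bsub>BijGroup X\<^esub> y) Q"
          using y by (intro mult[symmetric]) auto
        also have "inv\<^bsub>BijGroup X\<^esub> y \<otimes>\<^bsub>BijGroup X\<^esub> y = (\<lambda>x\<in>X. x)"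
          using l_inv[OF H.mem_carrier[OF y(1)]] by (simp add: BijGroup_simps(2))
        also have "lp_act (\<lambda>x\<in>X. x) Q = Q" by (rule lp_act_one[OF Q X])
        finally show "inv\<^bsub>BijGroup X\<^esub> y \<otimes>\<^bsub>BijGroup X\<^esub> x \<in> H \<and>
            lp_act (inv\<^bsub>BijGroup X\<^esub> y \<otimes>\<^bsub>BijGroup X\<^esub> x) Q = Q"
          using x y by simp
      qed
    qed (use y mult H.mem_carrier in \<open>auto simp: m_assoc[symmetric]\<close>)
    from bij_betw_same_card[OF this] show ?thesis by (rule sym)
  qed
  have "(\<Sum>x\<in>H. \<phi> (lp_act x Q)) =
      (\<Sum>R\<in>(\<lambda>x. lp_act x Q) ` H. \<Sum>x | x \<in> H \<and> lp_act x Q = R. \<phi> (lp_act x Q))"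
    by (rule sum.image_gen[OF fin])
  also have "\<dots> = (\<Sum>R\<in>(\<lambda>x. lp_act x Q) ` H. of_nat (card ?K) * \<phi> R)"
    by (intro sum.cong refl) (simp add: fiber)
  finally show ?thesis by (simp add: sum_distrib_left)
qed

text \<open>For x in H, the element x^(-1) g x stabilizes Q iff g stabilizes xQ, and then
  conjugation invariance turns the summand into the coefficient of xQ at g. Summing over H counts
  each orbit element \<open>card K\<close> times, which the denominator of the induced character
  cancels.\<close>

lemma ind_res_h_star_nth:
  assumes Q: "labelled_poset Q" and X: "lp_elems Q = X" and H: "subgroup H (BijGroup X)"
    and G: "G = (BijGroup X)\<lparr>carrier := H\<rparr>" and g: "g \<in> H"
  shows "ind_char G (stabilizer G lp_act Q)
      (res_char (stabilizer G lp_act Q) (fps_nth (h_star (lp_aut_group Q) Q) n)) g =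
    (\<Sum>R\<in>orbit G lp_act Q. if lp_act g R = R then h_star_coeff R n g else 0)"
proof -
  interpret group "BijGroup X" by (rule group_BijGroup)
  interpret H: subgroup H "BijGroup X" by fact
  let ?K = "{g \<in> H. lp_act g Q = Q}"
  let ?\<phi> = "\<lambda>R. if lp_act g R = R then h_star_coeff R n g else 0"
  have finX: "finite X" using labelled_posetD(1)[OF Q] X by simp
  have fin: "finite H" by (rule finite_subgroup_BijGroup[OF H finX])
  have K: "stabilizer G lp_act Q = ?K" by (simp add: stabilizer_def G)
  have orbit: "orbit G lp_act Q = (\<lambda>x. lp_act x Q) ` H" by (auto simp: orbit_def G)
  have Bij: "h \<in> Bij X" if "h \<in> H" for h using H.subset that by (auto simp: BijGroup_simps)
  have inv: "inv\<^bsub>G\<^esub> x = inv\<^bsub>BijGroup X\<^esub> x" if "x \<in> H" for x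
    using that m_inv_consistent[OF H] by (simp add: G)
  have aut: "lp_aut_group Q = (BijGroup X)\<lparr>carrier := lp_aut Q\<rparr>" "subgroup (lp_aut Q) (BijGroup X)"
    using subgroup_lp_aut[OF Q] by (simp_all add: lp_aut_group_def X)
  have summand: "(if inv\<^bsub>BijGroup X\<^esub> x \<otimes>\<^bsub>BijGroup X\<^esub> g \<otimes>\<^bsub>BijGroup X\<^esub> x \<in> ?K
      then fps_nth (h_star (lp_aut_group Q) Q) n (inv\<^bsub>BijGroup X\<^esub> x \<otimes>\<^bsub>BijGroup X\<^esub> g \<otimes>\<^bsub>BijGroup X\<^esub> x)
      else 0) = ?\<phi> (lp_act x Q)" if x: "x \<in> H" for x
  proof -
    let ?k = "inv\<^bsub>BijGroup X\<^esub> x \<otimes>\<^bsub>BijGroup X\<^esub> g \<otimes>\<^bsub>BijGroup X\<^esub> x"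
    have kH: "?k \<in> H" using x g by simp
    have xk: "x \<otimes>\<^bsub>BijGroup X\<^esub> ?k = g \<otimes>\<^bsub>BijGroup X\<^esub> x"
      using x g H.mem_carrier by (simp add: m_assoc[symmetric])
    have conj: "x (?k p) = g (x p)" if "p \<in> X" for p
      using fun_cong[OF xk, of p] that BijGroup_simps(3)[OF Bij[OF x] Bij[OF kH]]
        BijGroup_simps(3)[OF Bij[OF g] Bij[OF x]] by (simp add: compose_def)
    have "lp_act x (lp_act ?k Q) = lp_act g (lp_act x Q)"
      using lp_act_mult[OF Q X Bij[OF x] Bij[OF kH]] lp_act_mult[OF Q X Bij[OF g] Bij[OF x]] xk by simp
    moreover have "lp_act ?k Q = Q" if "lp_act x (lp_act ?k Q) = lp_act x Q"
    proof -
      let ?y = "inv\<^bsub>BijGroup X\<^esub> x"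
      have y: "?y \<in> H" using x by simp
      have canc: "lp_act ?y (lp_act x R) = R" if "labelled_poset R" "lp_elems R = X" for R
        using lp_act_mult[OF that Bij[OF y] Bij[OF x]] l_inv[OF H.mem_carrier[OF x]] lp_act_one[OF that]
        by (simp add: BijGroup_simps(2))
      have "labelled_poset (lp_act ?k Q)" "lp_elems (lp_act ?k Q) = X"
        using labelled_poset_act[OF Q X Bij[OF kH]] lp_elems_act[OF Q X Bij[OF kH]] .
      then show ?thesis using canc[of "lp_act ?k Q"] canc[OF Q X] that by simp
    qed
    ultimately have stab: "?k \<in> ?K \<longleftrightarrow> lp_act g (lp_act x Q) = lp_act x Q"
      using kH by auto
    have "fps_nth (h_star (lp_aut_group Q) Q) n ?k = h_star_coeff (lp_act x Q) n g" if "?k \<in> ?K"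
    proof -
      have "?k \<in> lp_aut Q" using that Bij[OF kH] lp_aut_iff[OF Q] X by simp
      then have "fps_nth (h_star (lp_aut_group Q) Q) n ?k = h_star_coeff Q n ?k"
        using h_star_nth[OF Q X aut(2,1)] by simp
      also have "\<dots> = h_star_coeff (lp_act x Q) n g"
        by (rule h_star_coeff_conj[of Q X x g ?k, OF Q X Bij[OF x] Bij[OF g] Bij[OF kH] conj])
      finally show ?thesis .
    qed
    then show ?thesis using stab by simp
  qed
  define m where "m x = inv\<^bsub>BijGroup X\<^esub> x \<otimes>\<^bsub>BijGroup X\<^esub> g \<otimes>\<^bsub>BijGroup X\<^esub> x" for x
  let ?h = "fps_nth (h_star (lp_aut_group Q) Q) n"
  have carrier: "carrier G = H" by (simp add: G)
  have m: "inv\<^bsub>G\<^esub> x \<otimes>\<^bsub>G\<^esub> g \<otimes>\<^bsub>G\<^esub> x = m x" if "x \<in> H" for x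
    unfolding inv[OF that] m_def by (simp add: G)
  have set: "{x \<in> carrier G. inv\<^bsub>G\<^esub> x \<otimes>\<^bsub>G\<^esub> g \<otimes>\<^bsub>G\<^esub> x \<in> ?K} = {x \<in> H. m x \<in> ?K}"
    unfolding carrier by (rule Collect_cong) (simp add: m cong: conj_cong)
  have "ind_char G ?K (res_char ?K ?h) g = (\<Sum>x\<in>{x \<in> H. m x \<in> ?K}. ?h (m x)) / of_nat (card ?K)"
  proof -
    have "ind_char G ?K (res_char ?K ?h) g =
        (\<Sum>x\<in>{x \<in> H. m x \<in> ?K}. res_char ?K ?h (inv\<^bsub>G\<^esub> x \<otimes>\<^bsub>G\<^esub> g \<otimes>\<^bsub>G\<^esub> x)) / of_nat (card ?K)"
      unfolding ind_char_def set using g by (simp only: carrier if_True)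
    also have "(\<Sum>x\<in>{x \<in> H. m x \<in> ?K}. res_char ?K ?h (inv\<^bsub>G\<^esub> x \<otimes>\<^bsub>G\<^esub> g \<otimes>\<^bsub>G\<^esub> x)) =
        (\<Sum>x\<in>{x \<in> H. m x \<in> ?K}. ?h (m x))"
      by (intro sum.cong) (auto simp: m res_char_def)
    finally show ?thesis .
  qed
  also have "(\<Sum>x\<in>{x \<in> H. m x \<in> ?K}. ?h (m x)) = (\<Sum>x\<in>H. if m x \<in> ?K then ?h (m x) else 0)"
    by (rule sum.inter_filter[OF fin])
  also have "\<dots> = (\<Sum>x\<in>H. ?\<phi> (lp_act x Q))"
    by (rule sum.cong[OF refl]) (unfold m_def, rule summand)
  also have "(\<Sum>x\<in>H. ?\<phi> (lp_act x Q)) / of_nat (card ?K) = (\<Sum>R\<in>orbit G lp_act Q. ?\<phi> R)"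
  proof -
    \<comment> \<open>The identity shows that the stabilizer has nonzero cardinality, so the
      division cancels.\<close>
    have "(\<lambda>x\<in>X. x) \<in> ?K"
      using H.one_closed lp_act_one[OF Q X] by (simp add: BijGroup_simps(2))
    moreover have "finite ?K" using fin by simp
    ultimately have "card ?K \<noteq> 0" by (metis card_0_eq empty_iff)
    then show ?thesis
      using sum_orbit[OF Q X H fin, of ?\<phi>] by (simp add: orbit)
  qed
  finally show ?thesis by (simp add: K)
qed

theorem theorem3p6:
  fixes P :: "'a lposet" and H :: "('a \<Rightarrow> 'a) set"
    and G :: "('a \<Rightarrow> 'a) monoid"
    and Q :: "nat \<Rightarrow> 'a lposet" and k :: nat
  assumes "eps_consistent P"
    and "subgroup H (lp_aut_group P)"
    and "G = (lp_aut_group P)\<lparr>carrier := H\<rparr>"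
    and "\<And>i. i \<in> {1..k} \<Longrightarrow> Q i \<in> saturations P"
    and "bij_betw (\<lambda>i. orbit G lp_act (Q i)) {1..k} (orbits G (saturations P) lp_act)"
  shows "(\<forall>i\<in>{1..k}. subgroup (stabilizer G lp_act (Q i)) (lp_aut_group (Q i))) \<and>
    h_star G P =
      (\<Sum>i = 1..k.
         fps_coeffwise (ind_char G (stabilizer G lp_act (Q i)))
           (fps_coeffwise (res_char (stabilizer G lp_act (Q i)))
             (h_star (lp_aut_group (Q i)) (Q i))))"
proof
  define X where "X = lp_elems P"
  have P: "labelled_poset P" using assms(1) by (simp add: eps_consistent_def)
  interpret B: group "BijGroup X" by (rule group_BijGroup)
  have "subgroup (lp_aut P) (BijGroup X)"
    using subgroup_lp_aut[OF P] by (simp add: X_def)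
  then have H: "subgroup H (BijGroup X)"
    using B.incl_subgroup assms(2) by (auto simp: lp_aut_group_def X_def)
  have G: "G = (BijGroup X)\<lparr>carrier := H\<rparr>"
    using assms(3) by (simp add: lp_aut_group_def X_def)
  have Haut: "g \<in> lp_aut P" if "g \<in> H" for g
    using subgroup.subset[OF assms(2)] that by (auto simp: lp_aut_group_def)
  have sat: "labelled_poset R" "lp_elems R = X" if "R \<in> saturations P" for R
    using that saturationD[of P R] by (simp_all add: saturations_def X_def)
  show "\<forall>i\<in>{1..k}. subgroup (stabilizer G lp_act (Q i)) (lp_aut_group (Q i))"
  proof
    fix i assume "i \<in> {1..k}"
    note Qi = sat[OF assms(4)[OF this]]
    have K: "stabilizer G lp_act (Q i) = {g \<in> H. lp_act g (Q i) = Q i}"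
      by (simp add: stabilizer_def G)
    have "g \<in> Bij X" if "g \<in> H" for g
      using subgroup.subset[OF H] that by (auto simp: BijGroup_simps)
    then have "stabilizer G lp_act (Q i) \<subseteq> lp_aut (Q i)"
      using lp_aut_iff[OF Qi(1)] Qi(2) by (auto simp: K)
    moreover have "subgroup (lp_aut (Q i)) (BijGroup X)"
      using subgroup_lp_aut[OF Qi(1)] Qi(2) by simp
    ultimately show "subgroup (stabilizer G lp_act (Q i)) (lp_aut_group (Q i))"
      using B.subgroup_incl[OF subgroup_fixing_lposet[OF Qi H]] by (simp add: lp_aut_group_def Qi K)
  qed
  have "finite X" using labelled_posetD(1)[OF P] by (simp add: X_def)
  then have finH: "finite H" by (rule finite_subgroup_BijGroup[OF H])
  have orbit: "orbit G lp_act R = (\<lambda>x. lp_act x R) ` H" for R by (auto simp: orbit_def G)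
  have orbits: "orbits G (saturations P) lp_act = (\<lambda>i. orbit G lp_act (Q i)) ` {1..k}"
    using assms(5) by (simp add: bij_betw_def)
  have union: "saturations P = (\<Union>i\<in>{1..k}. orbit G lp_act (Q i))"
  proof
    show "saturations P \<subseteq> (\<Union>i\<in>{1..k}. orbit G lp_act (Q i))"
    proof
      fix R assume R: "R \<in> saturations P"
      have "R \<in> orbit G lp_act R"
        unfolding orbit using lp_act_one[OF sat[OF R]] subgroup.one_closed[OF H]
        by (auto simp: BijGroup_simps(2) intro!: rev_image_eqI)
      moreover have "orbit G lp_act R \<in> orbits G (saturations P) lp_act"
        using R by (auto simp: orbits_def)
      ultimately show "R \<in> (\<Union>i\<in>{1..k}. orbit G lp_act (Q i))" unfolding orbits by blast
    qed
    show "(\<Union>i\<in>{1..k}. orbit G lp_act (Q i)) \<subseteq> saturations P"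
      using assms(4) saturation_act Haut unfolding orbit saturations_def by blast
  qed
  have disj: "orbit G lp_act (Q i) \<inter> orbit G lp_act (Q j) = {}"
    if "i \<in> {1..k}" "j \<in> {1..k}" "i \<noteq> j" for i j
  proof (rule ccontr)
    assume "orbit G lp_act (Q i) \<inter> orbit G lp_act (Q j) \<noteq> {}"
    then obtain x y where xy: "x \<in> H" "y \<in> H" "lp_act x (Q i) = lp_act y (Q j)"
      unfolding orbit by auto
    have "orbit G lp_act (Q i) = orbit G lp_act (Q j)"
      using orbit_lp_act[OF sat[OF assms(4)[OF that(1)]] H xy(1)]
        orbit_lp_act[OF sat[OF assms(4)[OF that(2)]] H xy(2)]
      unfolding orbit xy(3) by simp
    then show False
      using bij_betw_imp_inj_on[OF assms(5)] that by (auto dest: inj_onD)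
  qed
  \<comment> \<open>Finiteness is read off from the representatives: there are k orbits of a finite
    group.\<close>
  have fin: "finite (saturations P)"
    unfolding union orbit using finH by simp
  have "fps_nth (h_star G P) n g = (\<Sum>i = 1..k. ind_char G (stabilizer G lp_act (Q i))
      (res_char (stabilizer G lp_act (Q i)) (fps_nth (h_star (lp_aut_group (Q i)) (Q i)) n)) g)" for n g
  proof (cases "g \<in> H")
    case True
    let ?\<phi> = "\<lambda>R. if lp_act g R = R then h_star_coeff R n g else 0"
    have "fps_nth (h_star G P) n g = (\<Sum>R\<in>saturations P. ?\<phi> R)"
      using h_star_nth[OF P X_def[symmetric] H G] True
        h_star_coeff_decomposition[OF assms(1) Haut[OF True] fin] by simp
    also have "\<dots> = (\<Sum>i = 1..k. \<Sum>R\<in>orbit G lp_act (Q i). ?\<phi> R)"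
      unfolding union using disj finH by (intro sum.UNION_disjoint) (auto simp: orbit)
    also have "\<dots> = (\<Sum>i = 1..k. ind_char G (stabilizer G lp_act (Q i))
        (res_char (stabilizer G lp_act (Q i)) (fps_nth (h_star (lp_aut_group (Q i)) (Q i)) n)) g)"
      by (intro sum.cong refl ind_res_h_star_nth[OF sat H G True, symmetric] assms(4))
    finally show ?thesis .
  next
    \<comment> \<open>Off H both sides are 0, by the convention that characters are extended by
      0.\<close>
    case False
    then show ?thesis
      using h_star_nth[OF P X_def[symmetric] H G] by (simp add: ind_char_def G)
  qed
  then show "h_star G P =
      (\<Sum>i = 1..k.
         fps_coeffwise (ind_char G (stabilizer G lp_act (Q i)))
           (fps_coeffwise (res_char (stabilizer G lp_act (Q i)))
             (h_star (lp_aut_group (Q i)) (Q i))))"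
    by (intro fps_ext ext) (simp add: fps_sum_nth sum_fun_apply fps_coeffwise_def)
qed

end
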